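(* Let $n\ge 11$ be an integer and let $p\ge p_{JL}=\frac{n-2\sqrt{n-1}}{n-4-2\sqrt{n-1}}$. Let $u_0$ be a measurable function on $\mathbb{R}^n$ with $0\le u_0(x)\le v_\infty(x)$, and let $u$ be the nonnegative solution of $u_t=\Delta u+u^p$, $u(x,0)=u_0(x)$ (as specified in the context). Suppose that there exist constants $b>0$ and $\ell\in(\sigma,n-\sigma)$ such that $$v_\infty(x)-b|x|^{-\ell}\le u_0(x)\quad\text{for all } |x|\ge 1.$$ Then there is a constant $C>0$ such that for all $t\ge 1$ $$\sup_{|x|\le\sqrt t}|x|^\sigma\big(v_\infty(x)-u(x,t)\big)\le Ct^{-\frac{\ell-\sigma}{2}}$$ and $$\sup_{|x|\ge\sqrt t}\big(v_\infty(x)-u(x,t)\big)\le Ct^{-\frac{\ell}{2}}.$$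
   Context: The singular steady state is $$v_\infty(x)=L|x|^{-\frac{2}{p-1}},\qquad L=\Big(\tfrac{2}{p-1}\big(n-2-\tfrac{2}{p-1}\big)\Big)^{\frac1{p-1}},\quad x\in\mathbb{R}^n\setminus\{0\}.$$ The number $\sigma$ is $$\sigma=\sigma(n,p)=\frac{n-2}{2}-\sqrt{\frac{(n-2)^2}{4}-\frac{2p}{p-1}\Big(n-2-\frac{2}{p-1}\Big)}.$$ The solution $u$: for $0\le u_0\le v_\infty$ and $N>0$, let $u^N$ be the global-in-time nonnegative classical solution (bounded on $\mathbb{R}^n\times[0,T]$ for each $T$; initial datum understood in the usual mild/Duhamel sense) of $u_t=\Delta u+u^p$ on $\mathbb{R}^n\times(0,\infty)$ with initial datum $\min\{u_0(x),N\}$. Then $u(x,t)=\lim_{N\to\infty}u^N(x,t)$. Suprema and pointwise inequalities are over $x\ne 0$. *)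

theory Defs
  imports "HOL-Analysis.Analysis"
begin

definition p_JL :: "nat \<Rightarrow> real" where
  "p_JL n = (real n - 2 * sqrt (real n - 1)) / (real n - 4 - 2 * sqrt (real n - 1))"

definition sigma_exp :: "nat \<Rightarrow> real \<Rightarrow> real" where
  "sigma_exp n p = (real n - 2) / 2
     - sqrt ((real n - 2)\<^sup>2 / 4 - 2 * p / (p - 1) * (real n - 2 - 2 / (p - 1)))"

definition L_const :: "nat \<Rightarrow> real \<Rightarrow> real" where
  "L_const n p = (2 / (p - 1) * (real n - 2 - 2 / (p - 1))) powr (1 / (p - 1))"

text \<open>Meaningful for \<open>x \<noteq> 0\<close> only: since \<open>0 powr a = 0\<close>, the value at the origin is \<open>0\<close>,
  so every inequality involving this function has to exclude the origin.\<close>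

definition v_infty :: "real \<Rightarrow> real ^ 'n \<Rightarrow> real" where
  "v_infty p x = L_const CARD('n) p * norm x powr (- 2 / (p - 1))"

definition heat_kernel :: "real \<Rightarrow> real ^ 'n \<Rightarrow> real" where
  "heat_kernel t x = (4 * pi * t) powr (- real CARD('n) / 2) * exp (- (norm x)\<^sup>2 / (4 * t))"

text \<open>Membership in \<open>C\<^sup>2\<^sup>,\<^sup>1\<close> on \<open>\<real>\<^sup>n \<times> (0,\<infinity>)\<close> together with the equation
  \<open>w\<^sub>t = \<Delta> w + w\<^sup>p\<close>; here \<open>Dw\<close> is the spatial gradient and \<open>D2w\<close> the spatial Hessian, whose trace
  is the Laplacian.\<close>

definition classical_heat_power :: "real \<Rightarrow> (real ^ 'n \<Rightarrow> real \<Rightarrow> real) \<Rightarrow> bool" where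
  "classical_heat_power p w \<longleftrightarrow>
     (\<exists>(wt :: real ^ 'n \<Rightarrow> real \<Rightarrow> real) (Dw :: real ^ 'n \<Rightarrow> real \<Rightarrow> real ^ 'n)
       (D2w :: real ^ 'n \<Rightarrow> real \<Rightarrow> real ^ 'n ^ 'n).
        continuous_on (UNIV \<times> {0<..}) (\<lambda>(x, t). w x t) \<and>
        continuous_on (UNIV \<times> {0<..}) (\<lambda>(x, t). wt x t) \<and>
        continuous_on (UNIV \<times> {0<..}) (\<lambda>(x, t). Dw x t) \<and>
        continuous_on (UNIV \<times> {0<..}) (\<lambda>(x, t). D2w x t) \<and>
        (\<forall>x. \<forall>t>0.
           ((\<lambda>s. w x s) has_real_derivative wt x t) (at t) \<and>
           ((\<lambda>y. w y t) has_derivative (\<lambda>h. Dw x t \<bullet> h)) (at x) \<and>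
           ((\<lambda>y. Dw y t) has_derivative (\<lambda>h. D2w x t *v h)) (at x) \<and>
           wt x t = trace (D2w x t) + w x t powr p))"

definition duhamel :: "real \<Rightarrow> (real ^ 'n \<Rightarrow> real) \<Rightarrow> (real ^ 'n \<Rightarrow> real \<Rightarrow> real) \<Rightarrow> bool" where
  "duhamel p w0 w \<longleftrightarrow>
     (\<forall>x. \<forall>t>0. w x t =
        (LINT y|lebesgue. heat_kernel t (x - y) * w0 y) +
        (LINT s:{0<..<t}|lborel. (LINT y|lborel. heat_kernel (t - s) (x - y) * w y s powr p)))"

text \<open>Nonnegativity is imposed for \<open>t > 0\<close> only; at \<open>t = 0\<close> it is a property of the datum \<open>w0\<close>.\<close>

definition global_solution :: "real \<Rightarrow> (real ^ 'n \<Rightarrow> real) \<Rightarrow> (real ^ 'n \<Rightarrow> real \<Rightarrow> real) \<Rightarrow> bool" where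
  "global_solution p w0 w \<longleftrightarrow>
     (\<forall>x. \<forall>t>0. 0 \<le> w x t) \<and>
     (\<forall>T>0. bounded ((\<lambda>(x, t). w x t) ` (UNIV \<times> {0..T}))) \<and>
     (\<forall>x. w x 0 = w0 x) \<and>
     classical_heat_power p w \<and>
     duhamel p w0 w"

text \<open>The origin is excluded because the limit may be infinite there, for instance when
  \<open>u0 = v_infty p\<close>.\<close>

definition limit_solution :: "real \<Rightarrow> (real ^ 'n \<Rightarrow> real) \<Rightarrow> (real ^ 'n \<Rightarrow> real \<Rightarrow> real) \<Rightarrow> bool" where
  "limit_solution p u0 u \<longleftrightarrow>
     (\<exists>uN :: real \<Rightarrow> real ^ 'n \<Rightarrow> real \<Rightarrow> real.
        (\<forall>N>0. global_solution p (\<lambda>x. min (u0 x) N) (uN N)) \<and>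
        (\<forall>x t. x \<noteq> 0 \<longrightarrow> t > 0 \<longrightarrow> ((\<lambda>N. uN N x t) \<longlongrightarrow> u x t) at_top))"

end

(*
  By convexity of s^p, the difference w = v_infty - u is a subsolution of the linear equation
  with the Hardy potential p v_infty^(p-1) = lambda / |x|^2, and sigma is the root of
  sigma (n - 2 - sigma) = lambda, so |x|^(-sigma) is a stationary solution of it. Writing
  w = |x|^(-sigma) z turns the equation into the radial heat equation in the fractional
  dimension d = n - 2 sigma >= 2, in which data of size (1 + |x|^2)^(-a) with
  a = (l - sigma) / 2 < d / 2 decay like t^(-a). An explicit self-similar supersolution
  (1 + t)^(-a) F (|x|^2 / (1 + t)) therefore bounds z, and both claims follow from
  w <= C |x|^(-sigma) t^(-a).

  The comparison is made for each approximation u^N. Adding a small multiple of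
  |x|^(-sigma) (1 + |x|^2)^(sigma/2) e^(K t) to the barrier makes it dominate v_infty near the
  origin (because 2 / (p - 1) < sigma) and near infinity, so a contact point stays in a compact
  set. Since u_0 is only measurable, the comparison near t = 0 uses the Duhamel formula: u^N is
  at least the heat semigroup applied to a continuous minorant of the datum.
*)

theory Submission
  imports Defs "HOL-Probability.Distributions" "HOL-Real_Asymp.Real_Asymp"
begin

section \<open>Exponents: the Joseph-Lundgren condition and \<open>sigma_exp\<close>\<close>

text \<open>With \<open>D\<close> as below, \<open>p_JL n = 1 + 4 / D\<close> and
  \<open>D > 0\<close>, so the hypothesis on \<open>p\<close> amounts to
  \<open>2 / (p - 1) \<le> D / 2\<close>. This form makes the discriminant inside
  \<open>sigma_exp\<close> nonnegative.\<close>

lemma p_JL_gt_one_and_singular_exponent_bound: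
  assumes "n \<ge> 11" "p \<ge> p_JL n"
  shows "p > 1" "2 / (p - 1) \<le> (real n - 4 - 2 * sqrt (real n - 1)) / 2"
proof -
  define D where "D = real n - 4 - 2 * sqrt (real n - 1)"
  have "(2 * sqrt (real n - 1))\<^sup>2 < (real n - 4)\<^sup>2"
  proof -
    \<comment> \<open>The difference of the two squares equals this product plus 9.\<close>
    have "0 \<le> (real n - 11) * (real n - 1)"
      using assms(1) by (intro mult_nonneg_nonneg) auto
    moreover have "real n \<ge> 11" "(2 * sqrt (real n - 1))\<^sup>2 = 4 * (real n - 1)"
      using assms(1) by (auto simp: power_mult_distrib)
    ultimately show ?thesis
      by (simp add: power2_eq_square algebra_simps)
  qed
  then have "2 * sqrt (real n - 1) < real n - 4"
    by (rule power2_less_imp_less) (use assms(1) in auto)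
  then have D: "D > 0" by (simp add: D_def)
  have "p_JL n = 1 + 4 / D"
    using D by (simp add: p_JL_def D_def field_simps)
  with assms(2) have p: "p - 1 \<ge> 4 / D" by simp
  have D4: "4 / D > 0" using D by simp
  from less_le_trans[OF this p] show "p > 1" by simp
  have "2 / (p - 1) \<le> 2 / (4 / D)"
    using p D4 less_le_trans[OF D4 p] by (intro divide_left_mono mult_pos_pos) simp_all
  then show "2 / (p - 1) \<le> (real n - 4 - 2 * sqrt (real n - 1)) / 2"
    by (simp add: D_def)
qed

text \<open>Everything follows from \<open>p * m = m + 2\<close>, which turns the discriminant into
  a polynomial in \<open>m\<close>. The bound \<open>m < \<sigma>\<close> lets |x|^(-sigma) dominate
  \<open>v_infty\<close> at the origin, \<open>n - 2 * \<sigma>\<close> is the fractional dimension,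
  and the last equation says that |x|^(-sigma) solves the stationary Hardy equation.\<close>

lemma sigma_exp_properties:
  fixes n :: nat and p :: real
  assumes "n \<ge> 11" "p \<ge> p_JL n"
  defines "m \<equiv> 2 / (p - 1)" and "\<sigma> \<equiv> sigma_exp n p"
  shows "0 < m" "m < real n - 2" "m < \<sigma>" "2 \<le> real n - 2 * \<sigma>"
    and "\<sigma> * (real n - 2 - \<sigma>) = p * (m * (real n - 2 - m))"
proof -
  note pm = p_JL_gt_one_and_singular_exponent_bound[OF assms(1,2)]
  define R where "R = sqrt (real n - 1)"
  have R2: "R\<^sup>2 = real n - 1" and R0: "R \<ge> 0"
    using assms(1) by (auto simp: R_def)
  show m0: "0 < m" using pm(1) by (simp add: m_def)
  have mle: "m \<le> (real n - 4 - 2 * R) / 2" using pm(2) by (simp add: m_def R_def)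
  show mn: "m < real n - 2" using mle R0 assms(1) by (simp add: field_simps)
  have pmm: "p * m = m + 2"
    using pm(1) by (simp add: m_def field_simps)
  have lam: "p * (m * (real n - 2 - m)) = (m + 2) * (real n - 2 - m)"
    using pmm by (metis mult.assoc)
  define D where "D = (real n - 2)\<^sup>2 / 4 - p * (m * (real n - 2 - m))"
  have \<sigma>: "\<sigma> = (real n - 2) / 2 - sqrt D"
    by (simp add: \<sigma>_def sigma_exp_def D_def m_def mult.assoc)
  \<comment> \<open>Completing the square in this way exposes \<open>R\<close>, so that
    \<open>D \<ge> 0\<close> is the bound \<open>m \<le> (n - 4) / 2 - R\<close> squared.\<close>
  have "D = ((real n - 4) / 2 - m)\<^sup>2 - R\<^sup>2"
    unfolding D_def lam R2 by (simp add: power2_eq_square field_simps)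
  moreover have "R\<^sup>2 \<le> ((real n - 4) / 2 - m)\<^sup>2"
    using mle R0 by (intro power_mono) (auto simp: field_simps)
  ultimately have D0: "D \<ge> 0" by linarith
  then have sq: "(sqrt D)\<^sup>2 = D" by simp
  show "2 \<le> real n - 2 * \<sigma>" using D0 by (simp add: \<sigma> field_simps)
  \<comment> \<open>Taking roots here gives \<open>m < \<sigma>\<close>.\<close>
  have "D < ((real n - 2) / 2 - m)\<^sup>2"
  proof -
    have "((real n - 2) / 2 - m)\<^sup>2 - D = 2 * (real n - 2 - m)"
      unfolding D_def lam by (simp add: power2_eq_square field_simps)
    then show ?thesis using mn by (simp only: diff_eq_eq) simp
  qed
  then have "sqrt D < (real n - 2) / 2 - m"
    using mle R0 assms(1) by (intro real_less_lsqrt) (auto simp: field_simps)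
  then show "m < \<sigma>" by (simp add: \<sigma>)
  have "\<sigma> * (real n - 2 - \<sigma>) = (real n - 2)\<^sup>2 / 4 - (sqrt D)\<^sup>2"
    by (simp add: \<sigma> power2_eq_square field_simps)
  then show "\<sigma> * (real n - 2 - \<sigma>) = p * (m * (real n - 2 - m))"
    by (simp only: sq) (simp add: D_def)
qed

section \<open>The self-similar profile in fractional dimension\<close>

text \<open>
  The Gaussian part absorbs the defect of the power tail on a bounded set of \<open>y\<close>; this needs
  \<open>2 * a < d\<close>. The corrector of order \<open>- a - 1\<close> absorbs it for large \<open>y\<close>.
\<close>

lemma selfsimilar_supersolution_profile:
  fixes a d :: real
  assumes "0 < a" "2 * a < d" "1 \<le> d"
  obtains F F1 F2 :: "real \<Rightarrow> real" and M :: real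
  where "\<And>y. y > 0 \<Longrightarrow> (F has_real_derivative F1 y) (at y)"
    and "\<And>y. y > 0 \<Longrightarrow> (F1 has_real_derivative F2 y) (at y)"
    and "\<And>y. y > 0 \<Longrightarrow> 4 * y * F2 y + (2 * d + y) * F1 y + a * F y \<le> 0"
    and "\<And>y. y > 0 \<Longrightarrow> (1 + y) powr (- a) \<le> F y"
    and "\<And>y. y > 0 \<Longrightarrow> F y \<le> M"
proof -
  \<comment> \<open>The midpoint of two constraints: \<open>\<alpha> > a / (2 * d)\<close> makes
    \<open>\<eta>\<close> positive, and \<open>\<alpha> < 1 / 4\<close> gives the
    \<open>y\<close>-dependent part of the Gaussian contribution the right sign. The interval is
    nonempty because \<open>2 * a < d\<close>.\<close>
  define \<alpha> where "\<alpha> = (a / (2 * d) + 1 / 4) / 2"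
  have ad: "a / (2 * d) < 1 / 4" using assms by (simp add: field_simps)
  have ad0: "0 < a / (2 * d)" using assms by simp
  have \<alpha>: "a / (2 * d) < \<alpha>" "\<alpha> < 1 / 4" "0 < \<alpha>"
    using ad ad0 by (auto simp: \<alpha>_def)
  define \<eta> where "\<eta> = 2 * d * \<alpha> - a"
  have \<eta>: "\<eta> > 0" using \<alpha>(1) assms by (simp add: \<eta>_def field_simps)
  \<comment> \<open>The value exceeds \<open>4 * a * (a + 1)\<close> by one, so the corrector leaves
    a coefficient of at most -1 at \<open>v\<^sup>2\<close> below. The number \<open>c2\<close>
    bounds what the corrector produces at the next order.\<close>
  define c where "c = 4 * a * (a + 1) + 1"
  define c2 where "c2 = c * (4 * (a + 1) * (a + 2))"
  have c0: "c > 0" "c2 > 0"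
    unfolding c2_def c_def using assms by (intro mult_pos_pos add_nonneg_pos; simp)+
  \<comment> \<open>Chosen so that \<open>K * \<eta> * exp (- \<alpha> * y) \<ge> c2\<close> for
    \<open>y \<le> c2\<close>, the range where the power part may be positive.\<close>
  define K where "K = c2 * exp (\<alpha> * c2) / \<eta>"
  have K0: "K > 0" using c0 \<eta> by (simp add: K_def)
  define F where "F = (\<lambda>y. K * exp (- \<alpha> * y) + (1 + y) powr (- a) + c * (1 + y) powr (- a - 1))"
  define F1 where "F1 = (\<lambda>y. - \<alpha> * K * exp (- \<alpha> * y) - a * (1 + y) powr (- a - 1)
     - c * (a + 1) * (1 + y) powr (- a - 2))"
  define F2 where "F2 = (\<lambda>y. \<alpha>\<^sup>2 * K * exp (- \<alpha> * y) + a * (a + 1) * (1 + y) powr (- a - 2)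
     + c * (a + 1) * (a + 2) * (1 + y) powr (- a - 3))"
  have "(F has_real_derivative F1 y) (at y)" if "y > 0" for y
    unfolding F_def F1_def using that
    by (auto intro!: derivative_eq_intros simp: algebra_simps)
  moreover have "(F1 has_real_derivative F2 y) (at y)" if "y > 0" for y
    unfolding F1_def F2_def using that
    by (auto intro!: derivative_eq_intros simp: algebra_simps power2_eq_square)
  moreover have "4 * y * F2 y + (2 * d + y) * F1 y + a * F y \<le> 0" if y: "y > 0" for y
  proof -
    \<comment> \<open>Factoring out \<open>P\<close> leaves a polynomial in \<open>v\<close>. Its
      cubic term cancels, because \<open>y * F1 + a * F\<close> annihilates the leading order of
      \<open>v powr (- a)\<close>.\<close>
    define v where "v = 1 + y"
    define P where "P = v powr (- a - 3)"
    define E where "E = K * exp (- \<alpha> * y)"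
    have v: "v > 1" "y = v - 1" using y by (auto simp: v_def)
    have P0: "P > 0" using v by (simp add: P_def)
    have pw: "v powr (- a - 2) = v * P" "v powr (- a - 1) = v\<^sup>2 * P" "v powr (- a) = v ^ 3 * P"
    proof -
      have e: "- a - 2 = 1 + (- a - 3)" "- a - 1 = 2 + (- a - 3)" "- a = 3 + (- a - 3)"
        by simp_all
      show "v powr (- a - 2) = v * P" unfolding e(1) powr_add P_def using v by simp
      show "v powr (- a - 1) = v\<^sup>2 * P" unfolding e(2) powr_add P_def using v by simp
      show "v powr (- a) = v ^ 3 * P" unfolding P_def using v by (subst e(3), subst powr_add) simp
    qed
    have E0: "E > 0" using K0 by (simp add: E_def)
    have FE: "F y = E + v ^ 3 * P + c * (v\<^sup>2 * P)"
      "F1 y = - \<alpha> * E - a * (v\<^sup>2 * P) - c * (a + 1) * (v * P)"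
      "F2 y = \<alpha>\<^sup>2 * E + a * (a + 1) * (v * P) + c * (a + 1) * (a + 2) * P"
      unfolding F_def F1_def F2_def v_def [symmetric] pw by (simp_all add: E_def P_def)
    have "4 * y * F2 y + (2 * d + y) * F1 y + a * F y =
       E * (4 * y * \<alpha>\<^sup>2 - (2 * d + y) * \<alpha> + a) +
       P * (v\<^sup>2 * (4 * a * (a + 1) - a * (2 * d - 1) - c) - 4 * a * (a + 1) * v
         + c * (v * (4 * (a + 1) * (a + 2) - (a + 1) * (2 * d - 1)) - 4 * (a + 1) * (a + 2)))"
      unfolding FE unfolding v(2) P_def [symmetric]
      by (simp add: algebra_simps power2_eq_square power3_eq_cube)
    also have "\<dots> \<le> E * (- \<eta>) + P * v * (c2 - v)"
    proof (intro add_mono)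
      have "4 * y * \<alpha>\<^sup>2 - (2 * d + y) * \<alpha> + a = - \<eta> - \<alpha> * y * (1 - 4 * \<alpha>)"
        by (simp add: \<eta>_def power2_eq_square algebra_simps)
      also have "\<dots> \<le> - \<eta>" using \<alpha> y by simp
      finally show "E * (4 * y * \<alpha>\<^sup>2 - (2 * d + y) * \<alpha> + a) \<le> E * (- \<eta>)"
        using E0 by (intro mult_left_mono) auto
      have "v\<^sup>2 * (4 * a * (a + 1) - a * (2 * d - 1) - c) \<le> v\<^sup>2 * (- 1)"
        using assms by (intro mult_left_mono) (auto simp: c_def)
      moreover have "0 \<le> 4 * a * (a + 1) * v" "0 \<le> c * (4 * (a + 1) * (a + 2))"
        "0 \<le> c * (v * ((a + 1) * (2 * d - 1)))"
        using assms v c0 by auto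
      ultimately have "v\<^sup>2 * (4 * a * (a + 1) - a * (2 * d - 1) - c) - 4 * a * (a + 1) * v
         + c * (v * (4 * (a + 1) * (a + 2) - (a + 1) * (2 * d - 1)) - 4 * (a + 1) * (a + 2))
         \<le> v * (c2 - v)"
        by (simp add: c2_def power2_eq_square algebra_simps)
      from mult_left_mono[OF this, of P] P0
      show "P * (v\<^sup>2 * (4 * a * (a + 1) - a * (2 * d - 1) - c) - 4 * a * (a + 1) * v
         + c * (v * (4 * (a + 1) * (a + 2) - (a + 1) * (2 * d - 1)) - 4 * (a + 1) * (a + 2)))
         \<le> P * v * (c2 - v)" by (simp add: mult.assoc)
    qed
    also have "\<dots> \<le> 0"
    proof (cases "v \<ge> c2")
      case True
      have "P * v * (c2 - v) \<le> 0" using True P0 v by (intro mult_nonneg_nonpos) auto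
      moreover have "E * (- \<eta>) \<le> 0" using E0 \<eta> by simp
      ultimately show ?thesis by linarith
    next
      case False
      have "P * v = v powr (- a - 2)" using pw by (simp add: mult.commute)
      also have "\<dots> \<le> v powr 0" using v assms by (intro powr_mono) auto
      also have "\<dots> = 1" using v by simp
      finally have "P * v * (c2 - v) \<le> 1 * c2"
        using False v P0 by (intro mult_mono) auto
      moreover have "c2 \<le> E * \<eta>"
      proof -
        have "exp 0 \<le> exp (\<alpha> * (c2 - y))"
          using False v \<alpha> unfolding exp_le_cancel_iff by (intro mult_nonneg_nonneg) auto
        then have "c2 * 1 \<le> c2 * exp (\<alpha> * c2 - \<alpha> * y)"
          using c0 by (intro mult_left_mono) (auto simp: algebra_simps)
        also have "\<dots> = E * \<eta>" using \<eta> by (simp add: E_def K_def exp_diff exp_minus field_simps)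
        finally show ?thesis by simp
      qed
      ultimately show ?thesis by simp
    qed
    finally show ?thesis .
  qed
  moreover have "(1 + y) powr (- a) \<le> F y" if "y > 0" for y
    using K0 c0 by (simp add: F_def)
  moreover have "F y \<le> K + 1 + c" if "y > 0" for y
  proof -
    have "(1 + y) powr (- a) \<le> (1 + y) powr 0" "(1 + y) powr (- a - 1) \<le> (1 + y) powr 0"
      using that assms by (intro powr_mono; simp)+
    moreover have "exp (- \<alpha> * y) \<le> 1" using that \<alpha> by simp
    ultimately show ?thesis unfolding F_def using that K0 c0
      by (intro add_mono) auto
  qed
  ultimately show thesis by (rule that)
qed

section \<open>Comparison principle for radial subsolutions\<close>

lemma second_derivative_nonneg_at_local_min:
  fixes f :: "real \<Rightarrow> real"
  assumes "e > 0" and f: "\<And>h. \<bar>h\<bar> < e \<Longrightarrow> (f has_real_derivative f1 h) (at h)"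
    and f1: "(f1 has_real_derivative c) (at 0)"
    and min: "\<And>h. \<bar>h\<bar> < e \<Longrightarrow> f 0 \<le> f h"
  shows "c \<ge> 0"
proof (rule ccontr)
  assume "\<not> c \<ge> 0"
  then have "c < 0" by simp
  have "f1 0 = 0"
    by (rule DERIV_local_min[of f _ 0 e]) (use f[of 0] min \<open>e > 0\<close> in auto)
  with DERIV_neg_dec_right[OF f1 \<open>c < 0\<close>] obtain k where k: "k > 0"
    "\<And>h. 0 < h \<Longrightarrow> h < k \<Longrightarrow> f1 h < 0" by auto
  define h where "h = min (e / 2) (k / 2)"
  have h: "0 < h" "h < e" "h < k" using k(1) \<open>e > 0\<close> by (auto simp: h_def)
  have "f h < f 0"
  proof (rule DERIV_neg_imp_decreasing_open[OF h(1)])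
    fix x assume x: "0 < x" "x < h"
    then show "\<exists>y. (f has_real_derivative y) (at x) \<and> y < 0"
      using f[of x] k(2)[of x] h by auto
  next
    have "continuous_on {- h..h} f"
      using f h(2) by (intro DERIV_continuous_on[of _ _ f1])
        (force intro: has_field_derivative_at_within)+
    then show "continuous_on {0..h} f"
      by (rule continuous_on_subset) (use h in auto)
  qed
  with min[of h] h show False by auto
qed

text \<open>The one-dimensional second derivative test is applied along each coordinate line through
  \<open>x\<close>, and the resulting inequalities are summed. The terms with \<open>Q1\<close> and
  \<open>q2\<close> are the Laplacian of the radial part, expressed in
  \<open>s = x \<bullet> x\<close>.\<close>

lemma trace_Hessian_at_local_min_plus_radial:
  fixes u :: "real ^ 'n \<Rightarrow> real" and Du :: "real ^ 'n \<Rightarrow> real ^ 'n" and x :: "real ^ 'n"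
    and Q Q1 :: "real \<Rightarrow> real"
  assumes x: "x \<noteq> 0"
    and u: "\<And>y. (u has_derivative (\<lambda>h. Du y \<bullet> h)) (at y)"
    and Du: "(Du has_derivative (\<lambda>h. D2u *v h)) (at x)"
    and Q: "\<And>s. s > 0 \<Longrightarrow> (Q has_real_derivative Q1 s) (at s)"
    and Q1: "(Q1 has_real_derivative q2) (at (x \<bullet> x))"
    and min: "\<And>y. y \<noteq> 0 \<Longrightarrow> u x + Q (x \<bullet> x) \<le> u y + Q (y \<bullet> y)"
  shows "0 \<le> trace D2u + 2 * real CARD('n) * Q1 (x \<bullet> x) + 4 * (x \<bullet> x) * q2"
proof -
  have *: "0 \<le> D2u $ i $ i + 2 * Q1 (x \<bullet> x) + 4 * (x $ i)\<^sup>2 * q2" for i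
  proof -
    define e :: "real ^ 'n" where "e = axis i 1"
    have ee: "e \<bullet> e = 1" and xe: "x \<bullet> e = x $ i"
      by (auto simp: e_def inner_axis_axis inner_axis)
    define \<gamma> where "\<gamma> = (\<lambda>h. x + h *\<^sub>R e)"
    \<comment> \<open>The squared norm along the line is a quadratic polynomial in \<open>h\<close>.
      It stays positive for \<open>\<bar>h\<bar> < norm x\<close>, which keeps the line away from
      the origin, where nothing is known about \<open>Q\<close>.\<close>
    define S where "S = (\<lambda>h. x \<bullet> x + 2 * h * (x $ i) + h\<^sup>2)"
    have S: "\<gamma> h \<bullet> \<gamma> h = S h" for h
      by (simp add: \<gamma>_def S_def inner_add_left inner_add_right inner_commute[of e x] xe ee
          power2_eq_square algebra_simps)
    have nz: "\<gamma> h \<noteq> 0" if "\<bar>h\<bar> < norm x" for h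
    proof
      assume "\<gamma> h = 0"
      then have "x = - (h *\<^sub>R e)" by (simp add: \<gamma>_def eq_neg_iff_add_eq_0)
      then have "norm x = \<bar>h\<bar>" using ee by (simp add: norm_eq_sqrt_inner)
      with that show False by simp
    qed
    have \<gamma>': "(\<gamma> has_derivative (\<lambda>k. k *\<^sub>R e)) (at h)" for h
      unfolding \<gamma>_def by (auto intro!: derivative_eq_intros)
    have S': "(S has_real_derivative 2 * x $ i + 2 * h) (at h)" for h
      unfolding S_def by (auto intro!: derivative_eq_intros)
    show ?thesis
    proof (rule second_derivative_nonneg_at_local_min[where e = "norm x"])
      show "norm x > 0" using x by simp
    next
      fix h assume h: "\<bar>h\<bar> < norm x"
      have "S h > 0" using nz[OF h] by (simp flip: S)
      have "((\<lambda>h. u (\<gamma> h)) has_derivative (\<lambda>k. Du (\<gamma> h) \<bullet> (k *\<^sub>R e))) (at h)"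
        by (rule has_derivative_compose[OF \<gamma>' u])
      moreover have "(\<lambda>k. Du (\<gamma> h) \<bullet> (k *\<^sub>R e)) = (*) (Du (\<gamma> h) \<bullet> e)"
        by auto
      ultimately have "((\<lambda>h. u (\<gamma> h)) has_real_derivative Du (\<gamma> h) \<bullet> e) (at h)"
        unfolding has_field_derivative_def by simp
      moreover have "((\<lambda>h. Q (S h)) has_real_derivative Q1 (S h) * (2 * x $ i + 2 * h)) (at h)"
        by (rule DERIV_chain2[OF Q S']) fact
      ultimately show "((\<lambda>h. u (\<gamma> h) + Q (S h)) has_real_derivative
          (Du (\<gamma> h) \<bullet> e + Q1 (S h) * (2 * x $ i + 2 * h))) (at h)"
        by (rule DERIV_add)
      show "u (\<gamma> 0) + Q (S 0) \<le> u (\<gamma> h) + Q (S h)"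
        using min[OF nz[OF h]] by (simp add: S) (simp add: \<gamma>_def S_def)
    next
      have "((\<lambda>h. Du (\<gamma> h)) has_derivative (\<lambda>k. D2u *v (k *\<^sub>R e))) (at 0)"
        by (rule has_derivative_compose[OF \<gamma>']) (use Du in \<open>simp add: \<gamma>_def\<close>)
      then have "((\<lambda>h. Du (\<gamma> h) \<bullet> e) has_derivative (\<lambda>k. (D2u *v (k *\<^sub>R e)) \<bullet> e)) (at 0)"
        by (rule has_derivative_inner_left)
      moreover have "(\<lambda>k. (D2u *v (k *\<^sub>R e)) \<bullet> e) = (*) (D2u $ i $ i)"
        by (auto simp: e_def inner_axis matrix_vector_mult_scaleR matrix_vector_mult_basis column_def)
      ultimately have "((\<lambda>h. Du (\<gamma> h) \<bullet> e) has_real_derivative D2u $ i $ i) (at 0)"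
        unfolding has_field_derivative_def by simp
      moreover have "((\<lambda>h. Q1 (S h)) has_real_derivative q2 * (2 * x $ i + 2 * 0)) (at 0)"
        by (rule DERIV_chain2[OF _ S']) (use Q1 in \<open>simp add: S_def\<close>)
      moreover have "((\<lambda>h. 2 * x $ i + 2 * h) has_real_derivative 2) (at 0)"
        by (auto intro!: derivative_eq_intros)
      ultimately show "((\<lambda>h. Du (\<gamma> h) \<bullet> e + Q1 (S h) * (2 * x $ i + 2 * h)) has_real_derivative
          (D2u $ i $ i + 2 * Q1 (x \<bullet> x) + 4 * (x $ i)\<^sup>2 * q2)) (at 0)"
        by (auto intro!: derivative_eq_intros simp: S_def power2_eq_square algebra_simps)
    qed
  qed
  have "0 \<le> (\<Sum>i\<in>UNIV. D2u $ i $ i + 2 * Q1 (x \<bullet> x) + 4 * (x $ i)\<^sup>2 * q2)"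
    by (intro sum_nonneg) (rule *)
  also have "\<dots> = trace D2u + 2 * real CARD('n) * Q1 (x \<bullet> x) + 4 * (x \<bullet> x) * q2"
    by (simp add: sum.distrib trace_def inner_vec_def power2_eq_square
        flip: sum_distrib_left sum_distrib_right)
  finally show ?thesis .
qed

text \<open>For a function \<open>q (x \<bullet> x) t\<close> the Laplacian in \<open>x\<close> is \<open>2 * n * q1 + 4 * s * q2\<close> at
  \<open>s = x \<bullet> x\<close>. The assumption \<open>bdry\<close> confines a contact point to a compact set.\<close>

lemma radial_strict_subsolution_less:
  fixes w :: "real ^ 'n \<Rightarrow> real \<Rightarrow> real" and q qt q1 q2 :: "real \<Rightarrow> real \<Rightarrow> real"
  assumes w: "classical_heat_power p w" and w0: "\<And>x t. t > 0 \<Longrightarrow> 0 \<le> w x t"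
    and cont: "continuous_on ({0<..} \<times> {0<..}) (\<lambda>(s, t). q s t)"
    and qt: "\<And>s t. s > 0 \<Longrightarrow> t > 0 \<Longrightarrow> ((\<lambda>t. q s t) has_real_derivative qt s t) (at t)"
    and q1: "\<And>s t. s > 0 \<Longrightarrow> t > 0 \<Longrightarrow> ((\<lambda>s. q s t) has_real_derivative q1 s t) (at s)"
    and q2: "\<And>s t. s > 0 \<Longrightarrow> t > 0 \<Longrightarrow> ((\<lambda>s. q1 s t) has_real_derivative q2 s t) (at s)"
    and sub: "\<And>s t. s > 0 \<Longrightarrow> t > 0 \<Longrightarrow> q s t \<ge> 0 \<Longrightarrow>
       qt s t < 2 * real CARD('n) * q1 s t + 4 * s * q2 s t + q s t powr p"
    and r: "0 < r1" "0 < \<tau>"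
    and bdry: "\<And>x t. x \<noteq> 0 \<Longrightarrow> 0 < t \<Longrightarrow> t \<le> T \<Longrightarrow> norm x < r1 \<or> norm x > r2 \<or> t < \<tau> \<Longrightarrow>
       q (x \<bullet> x) t < w x t"
    and xt: "x \<noteq> 0" "0 < t" "t \<le> T"
  shows "q (x \<bullet> x) t < w x t"
proof (rule ccontr)
  assume neg: "\<not> q (x \<bullet> x) t < w x t"
  obtain wt Dw D2w where W:
    "continuous_on (UNIV \<times> {0<..}) (\<lambda>(x, t). w x t)"
    "\<And>x t. t > 0 \<Longrightarrow> ((\<lambda>s. w x s) has_real_derivative wt x t) (at t)"
    "\<And>x t. t > 0 \<Longrightarrow> ((\<lambda>y. w y t) has_derivative (\<lambda>h. Dw x t \<bullet> h)) (at x)"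
    "\<And>x t. t > 0 \<Longrightarrow> ((\<lambda>y. Dw y t) has_derivative (\<lambda>h. D2w x t *v h)) (at x)"
    "\<And>x t. t > 0 \<Longrightarrow> wt x t = trace (D2w x t) + w x t powr p"
    using w unfolding classical_heat_power_def by metis
  define \<psi> where "\<psi> = (\<lambda>(x, t). w x t - q (x \<bullet> x) t)"
  define K where "K = ({x :: real ^ 'n. r1 \<le> norm x \<and> norm x \<le> r2} \<times> {\<tau>..T})"
  have cpt: "compact K"
  proof -
    have "{x :: real ^ 'n. r1 \<le> norm x \<and> norm x \<le> r2} = cball 0 r2 - ball 0 r1"
      by (auto simp: dist_norm)
    then show ?thesis unfolding K_def
      by (simp add: compact_Times compact_diff)
  qed
  have sub1: "K \<subseteq> (- {0}) \<times> {0<..}" using r by (auto simp: K_def)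
  have cq: "continuous_on ((- {0}) \<times> {0<..}) (\<lambda>(x :: real ^ 'n, t). q (x \<bullet> x) t)"
  proof -
    have "continuous_on ((- {0}) \<times> {0<..}) ((\<lambda>(s, t). q s t) \<circ> (\<lambda>(x :: real ^ 'n, t). (x \<bullet> x, t)))"
    proof (rule continuous_on_compose)
      show "continuous_on ((- {0}) \<times> {0<..}) (\<lambda>(x :: real ^ 'n, t :: real). (x \<bullet> x, t))"
        by (auto intro!: continuous_intros simp: case_prod_beta)
      show "continuous_on ((\<lambda>(x :: real ^ 'n, t). (x \<bullet> x, t)) ` ((- {0}) \<times> {0<..})) (\<lambda>(s, t). q s t)"
        by (rule continuous_on_subset[OF cont]) auto
    qed
    then show ?thesis by (simp add: o_def case_prod_beta)
  qed
  have c\<psi>: "continuous_on ((- {0}) \<times> {0<..}) \<psi>"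
  proof -
    have "continuous_on ((- {0}) \<times> {0<..}) (\<lambda>(x, t). w x t)"
      by (rule continuous_on_subset[OF W(1)]) auto
    from continuous_on_diff[OF this cq] show ?thesis
      by (simp add: \<psi>_def case_prod_beta)
  qed
  \<comment> \<open>The contact set. It is compact by \<open>bdry\<close>, so the time coordinate
    attains a minimum on it: the first contact time.\<close>
  define Z where "Z = {z \<in> K. \<psi> z \<le> 0}"
  have inZ: "(y, s) \<in> Z" if "y \<noteq> 0" "0 < s" "s \<le> T" "\<psi> (y, s) \<le> 0" for y s
    using that bdry[of y s] by (force simp: Z_def K_def \<psi>_def)
  have "compact Z"
  proof -
    have "closedin (top_of_set K) (K \<inter> \<psi> -` {..0})"
      by (rule continuous_closedin_preimage[OF continuous_on_subset[OF c\<psi> sub1]]) simp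
    moreover have "Z = K \<inter> \<psi> -` {..0}" by (auto simp: Z_def)
    ultimately show ?thesis using closedin_compact[OF cpt] by simp
  qed
  moreover have "Z \<noteq> {}" using inZ[of x t] xt neg by (auto simp: \<psi>_def)
  moreover have "continuous_on Z snd" by (intro continuous_intros)
  ultimately obtain z where z: "z \<in> Z" "\<And>z'. z' \<in> Z \<Longrightarrow> snd z \<le> snd z'"
    using continuous_attains_inf[of Z snd] by auto
  obtain y s where ys: "z = (y, s)" by (cases z)
  have y: "y \<noteq> 0" and s: "0 < s" "s \<le> T" and \<psi>z: "\<psi> (y, s) \<le> 0"
    using z(1) r unfolding ys by (auto simp: Z_def K_def)
  have yy: "y \<bullet> y > 0" using y by simp
  have early: "\<psi> (x', s') > 0" if "x' \<noteq> 0" "0 < s'" "s' < s" for x' s'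
    using inZ[of x' s'] z(2)[of "(x', s')"] that s by (force simp: ys)
  \<comment> \<open>The gap is positive before the first contact time, hence nonnegative at that
    time by continuity. So the contact point is a spatial minimum of the gap with value zero, and
    the time derivative there cannot be positive.\<close>
  have at_s: "\<psi> (x', s) \<ge> 0" if "x' \<noteq> 0" for x'
  proof (rule tendsto_lowerbound)
    have "continuous_on {0<..} (\<psi> \<circ> (\<lambda>s. (x', s)))"
      by (rule continuous_on_compose) (auto intro!: continuous_intros continuous_on_subset[OF c\<psi>]
          simp: that)
    then have "isCont (\<lambda>s. \<psi> (x', s)) s"
      using s by (simp add: continuous_on_eq_continuous_at o_def)
    then show "((\<lambda>s. \<psi> (x', s)) \<longlongrightarrow> \<psi> (x', s)) (at_left s)"
      unfolding isCont_def by (rule filterlim_mono) (auto intro: at_le)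
    show "\<forall>\<^sub>F s' in at_left s. 0 \<le> \<psi> (x', s')"
      using eventually_at_left_real[OF s(1)]
      by eventually_elim (use early that in \<open>auto intro!: less_imp_le\<close>)
  qed simp
  have eq0: "\<psi> (y, s) = 0" using \<psi>z at_s[OF y] by simp
  then have wq: "w y s = q (y \<bullet> y) s" by (simp add: \<psi>_def)
  have "wt y s - qt (y \<bullet> y) s \<le> 0"
  proof (rule ccontr)
    assume "\<not> ?thesis"
    then have "wt y s - qt (y \<bullet> y) s > 0" by simp
    moreover have "((\<lambda>s. \<psi> (y, s)) has_real_derivative wt y s - qt (y \<bullet> y) s) (at s)"
      unfolding \<psi>_def using W(2)[OF s(1)] qt[OF yy s(1)] by (auto intro: DERIV_diff)
    ultimately obtain k where k: "k > 0" "\<And>h. 0 < h \<Longrightarrow> h < k \<Longrightarrow> \<psi> (y, s - h) < \<psi> (y, s)"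
      using DERIV_pos_inc_left[of "\<lambda>s. \<psi> (y, s)"] by blast
    define h where "h = min (k / 2) (s / 2)"
    have "0 < h" "h < k" "h < s" using k(1) s by (auto simp: h_def)
    with k(2)[of h] early[of y "s - h"] y eq0 show False by auto
  qed
  moreover have "0 \<le> trace (D2w y s) + 2 * real CARD('n) * (- q1 (y \<bullet> y) s) + 4 * (y \<bullet> y) * (- q2 (y \<bullet> y) s)"
  proof (rule trace_Hessian_at_local_min_plus_radial[OF y W(3)[OF s(1)] W(4)[OF s(1)]])
    show "((\<lambda>s'. - q s' s) has_real_derivative - q1 s' s) (at s')" if "s' > 0" for s'
      by (rule DERIV_minus) (rule q1[OF that s(1)])
    show "((\<lambda>s'. - q1 s' s) has_real_derivative - q2 (y \<bullet> y) s) (at (y \<bullet> y))"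
      by (rule DERIV_minus) (rule q2[OF yy s(1)])
    show "w y s + - q (y \<bullet> y) s \<le> w y' s + - q (y' \<bullet> y') s" if "y' \<noteq> 0" for y'
      using at_s[OF that] eq0 by (simp add: \<psi>_def)
  qed
  \<comment> \<open>At the contact point \<open>q\<close> equals the nonnegative \<open>w\<close>,
    so \<open>sub\<close> applies although it is assumed only where \<open>q\<close> is
    nonnegative.\<close>
  moreover have "q (y \<bullet> y) s \<ge> 0" using w0[OF s(1), of y] wq by simp
  ultimately show False
    using sub[OF yy s(1)] W(5)[OF s(1), of y] wq by simp
qed

section \<open>The heat kernel and the behaviour of solutions near time zero\<close>

lemma heat_kernel_nonneg: "0 \<le> heat_kernel t x"
  by (simp add: heat_kernel_def)

text \<open>Each coordinate is normal with variance \<open>2 * t\<close>. The factorization reduces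
  the total mass of the kernel to one-dimensional Gaussian integrals.\<close>

lemma heat_kernel_eq_prod_normal_density:
  fixes x y :: "real ^ 'n"
  assumes "t > 0"
  shows "heat_kernel t (x - y) = (\<Prod>b\<in>Basis. normal_density (x \<bullet> b) (sqrt (2 * t)) (y \<bullet> b))"
proof -
  have "(\<Prod>b\<in>Basis. normal_density (x \<bullet> b) (sqrt (2 * t)) (y \<bullet> b)) =
      (\<Prod>b\<in>(Basis :: (real ^ 'n) set). (4 * pi * t) powr (- 1 / 2) * exp (- (y \<bullet> b - x \<bullet> b)\<^sup>2 / (4 * t)))"
    using assms by (intro prod.cong)
      (auto simp: normal_density_def powr_minus powr_half_sqrt inverse_eq_divide mult_ac)
  also have "\<dots> = ((4 * pi * t) powr (- 1 / 2)) ^ CARD('n) *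
      exp (\<Sum>b\<in>(Basis :: (real ^ 'n) set). - (y \<bullet> b - x \<bullet> b)\<^sup>2 / (4 * t))"
    by (simp add: prod.distrib exp_sum)
  also have "((4 * pi * t) powr (- 1 / 2)) ^ CARD('n) = (4 * pi * t) powr (- real CARD('n) / 2)"
    using assms by (simp add: powr_power)
  also have "(\<Sum>b\<in>(Basis :: (real ^ 'n) set). - (y \<bullet> b - x \<bullet> b)\<^sup>2 / (4 * t)) = - (norm (x - y))\<^sup>2 / (4 * t)"
  proof -
    have "(norm (x - y))\<^sup>2 = (\<Sum>b\<in>(Basis :: (real ^ 'n) set). (y \<bullet> b - x \<bullet> b)\<^sup>2)"
      unfolding power2_norm_eq_inner
      by (subst euclidean_inner) (simp add: inner_diff_left power2_eq_square algebra_simps)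
    then show ?thesis by (simp add: sum_negf sum_divide_distrib)
  qed
  finally show ?thesis by (simp add: heat_kernel_def)
qed

lemma has_bochner_integral_heat_kernel:
  fixes x :: "real ^ 'n"
  assumes "t > 0"
  shows "has_bochner_integral lborel (\<lambda>y. heat_kernel t (x - y)) 1"
proof (rule has_bochner_integral_nn_integral)
  show "(\<lambda>y. heat_kernel t (x - y)) \<in> borel_measurable lborel"
    unfolding heat_kernel_def by measurable
  have "(\<integral>\<^sup>+ y. heat_kernel t (x - y) \<partial>lborel) =
      (\<integral>\<^sup>+ y. (\<Prod>b\<in>Basis. ennreal (normal_density (x \<bullet> b) (sqrt (2 * t)) (y \<bullet> b))) \<partial>lborel)"
    by (simp add: heat_kernel_eq_prod_normal_density[OF assms] prod_ennreal)
  also have "\<dots> = (\<Prod>b\<in>(Basis :: (real ^ 'n) set).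
      (\<integral>\<^sup>+ z. ennreal (normal_density (x \<bullet> b) (sqrt (2 * t)) z) \<partial>lborel))"
    by (rule nn_integral_lborel_prod) auto
  also have "\<dots> = 1"
  proof (rule prod.neutral, rule ballI)
    fix b
    show "(\<integral>\<^sup>+ z. ennreal (normal_density (x \<bullet> b) (sqrt (2 * t)) z) \<partial>lborel) = 1"
      using assms by (subst nn_integral_eq_integral) auto
  qed
  finally show "(\<integral>\<^sup>+ y. heat_kernel t (x - y) \<partial>lborel) = ennreal 1" by simp
qed (auto simp: heat_kernel_nonneg)

lemmas integrable_heat_kernel = has_bochner_integral_heat_kernel[THEN integrable.intros]
lemmas integral_heat_kernel = has_bochner_integral_heat_kernel[THEN has_bochner_integral_integral_eq]

text \<open>Half of the Gaussian exponent is given up, which leaves the kernel at the doubled time.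
  This converts tail weights into a total mass.\<close>

lemma heat_kernel_times_exp:
  fixes z :: "real ^ 'n"
  assumes "t > 0"
  shows "heat_kernel t z * exp ((norm z)\<^sup>2 / (8 * t)) = 2 powr (CARD('n) / 2) * heat_kernel (2 * t) z"
proof -
  have "(4 * pi * (2 * t)) powr (- real CARD('n) / 2) =
      2 powr (- real CARD('n) / 2) * (4 * pi * t) powr (- real CARD('n) / 2)"
    using assms by (subst powr_mult [symmetric]) (auto simp: mult_ac)
  moreover have "2 powr (CARD('n) / 2) * 2 powr (- real CARD('n) / 2) = (1 :: real)"
    by (simp flip: powr_add)
  moreover have "exp (- (norm z)\<^sup>2 / (4 * t)) * exp ((norm z)\<^sup>2 / (8 * t)) =
      exp (- (norm z)\<^sup>2 / (4 * (2 * t)))"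
    using assms by (simp flip: exp_add)
  ultimately show ?thesis
    unfolding heat_kernel_def by (simp only: mult.assoc mult.left_commute) simp
qed

text \<open>The integral is over \<open>lebesgue\<close> because the datum is only Lebesgue
  measurable, and the bound holds almost everywhere because the datum is controlled only off the
  origin.\<close>

lemma integrable_heat_kernel_times_bounded:
  fixes f :: "real ^ 'n \<Rightarrow> real"
  assumes "t > 0" "f \<in> borel_measurable lebesgue" "AE y in lebesgue. \<bar>f y\<bar> \<le> B"
  shows "integrable lebesgue (\<lambda>y. heat_kernel t (x - y) * f y)"
proof (rule Bochner_Integration.integrable_bound)
  have m: "(\<lambda>y. heat_kernel t (x - y)) \<in> borel_measurable lborel"
    unfolding heat_kernel_def by measurable
  show "integrable lebesgue (\<lambda>y. heat_kernel t (x - y) * B)"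
    using integrable_heat_kernel[OF assms(1), of x] m
    by (intro integrable_mult_left) (simp add: integrable_completion)
  show "(\<lambda>y. heat_kernel t (x - y) * f y) \<in> borel_measurable lebesgue"
    using assms(2) measurable_completion[OF m] by measurable
  show "AE y in lebesgue. norm (heat_kernel t (x - y) * f y) \<le> norm (heat_kernel t (x - y) * B)"
    using assms(3)
  proof eventually_elim
    case (elim y)
    then show ?case
      by (auto simp: abs_mult heat_kernel_nonneg intro!: mult_left_mono)
  qed
qed

text \<open>The tail of the Gaussian is controlled by \<open>1 \<le> exp ((norm z)\<^sup>2 / (8 * t) - \<delta>\<^sup>2 / (8 * t))\<close>
  for \<open>norm z \<ge> \<delta>\<close>, which only requires the total mass of the kernel at time \<open>2 * t\<close>.\<close>

lemma heat_semigroup_lower_bound_small_time: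
  fixes g :: "real ^ 'n \<Rightarrow> real"
  assumes g: "continuous_on UNIV g" "\<And>y. 0 \<le> g y" "\<And>y. g y \<le> B" and "e > 0"
  obtains \<tau> where "\<tau> > 0"
    "\<And>x t. norm x \<le> R \<Longrightarrow> 0 < t \<Longrightarrow> t < \<tau> \<Longrightarrow>
      g x - e \<le> (LINT y|lebesgue. heat_kernel t (x - y) * g y)"
proof -
  have B: "B \<ge> 0" using g(2,3) order_trans by blast
  have "uniformly_continuous_on (cball 0 (R + 1)) g"
    by (intro compact_uniformly_continuous continuous_on_subset[OF g(1)]) auto
  then obtain \<delta>0 where \<delta>0: "\<delta>0 > 0" "\<And>x y. x \<in> cball 0 (R + 1) \<Longrightarrow> y \<in> cball 0 (R + 1) \<Longrightarrow>
      dist y x < \<delta>0 \<Longrightarrow> dist (g y) (g x) < e / 2"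
    using \<open>e > 0\<close> unfolding uniformly_continuous_on_def by (meson half_gt_zero)
  define \<delta> where "\<delta> = min \<delta>0 1"
  have \<delta>: "\<delta> > 0" using \<delta>0 by (simp add: \<delta>_def)
  have near: "\<bar>g y - g x\<bar> < e / 2" if "norm x \<le> R" "norm (x - y) < \<delta>" for x y
  proof -
    have "norm y \<le> norm x + norm (x - y)"
      by (metis norm_minus_commute norm_triangle_sub)
    then have "x \<in> cball 0 (R + 1)" "y \<in> cball 0 (R + 1)" "dist y x < \<delta>0"
      using that by (auto simp: \<delta>_def dist_norm norm_minus_commute)
    from \<delta>0(2)[OF this] show ?thesis by (simp add: dist_real_def)
  qed
  define A where "A = B * 2 powr (CARD('n) / 2)"
  have "((\<lambda>t. A * exp (- \<delta>\<^sup>2 / (8 * t))) \<longlongrightarrow> A * 0) (at_right 0)"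
    using \<delta> by (intro tendsto_intros) real_asymp
  then have "\<forall>\<^sub>F t in at_right 0. A * exp (- \<delta>\<^sup>2 / (8 * t)) < e / 2"
    using \<open>e > 0\<close> by (auto dest!: order_tendstoD(2)[of _ _ _ "e / 2"])
  then obtain \<tau> where \<tau>: "\<tau> > 0" "\<And>t. 0 < t \<Longrightarrow> t < \<tau> \<Longrightarrow> A * exp (- \<delta>\<^sup>2 / (8 * t)) < e / 2"
    by (auto simp: eventually_at_right_field)
  show thesis
  proof (rule that[OF \<tau>(1)])
    fix x :: "real ^ 'n" and t :: real
    assume x: "norm x \<le> R" and t: "0 < t" "t < \<tau>"
    define E where "E = exp (- \<delta>\<^sup>2 / (8 * t))"
    \<comment> \<open>One pointwise bound replaces splitting the domain: close to \<open>x\<close>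
      uniform continuity gives it, and at distance at least \<open>\<delta>\<close> the subtracted
      term exceeds \<open>B \<ge> g x\<close> after division by the kernel, so the left side is not
      positive.\<close>
    have pw: "(g x - e / 2) * heat_kernel t (x - y) - B * E * 2 powr (CARD('n) / 2) * heat_kernel (2 * t) (x - y)
        \<le> heat_kernel t (x - y) * g y" for y
    proof -
      have "g x - e / 2 - B * E * exp ((norm (x - y))\<^sup>2 / (8 * t)) \<le> g y"
      proof (cases "norm (x - y) < \<delta>")
        case True
        then have "g x - e / 2 \<le> g y" using near[OF x True] by linarith
        moreover have "0 \<le> B * E * exp ((norm (x - y))\<^sup>2 / (8 * t))" using B by (simp add: E_def)
        ultimately show ?thesis by linarith
      next
        case False
        then have "\<delta>\<^sup>2 \<le> (norm (x - y))\<^sup>2" using \<delta> by (intro power_mono) auto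
        then have "1 \<le> E * exp ((norm (x - y))\<^sup>2 / (8 * t))"
          using t by (simp add: E_def divide_right_mono flip: exp_add)
        then have "B * 1 \<le> B * (E * exp ((norm (x - y))\<^sup>2 / (8 * t)))"
          using B by (intro mult_left_mono)
        then show ?thesis using g(3)[of x] g(2)[of y] \<open>e > 0\<close> by (simp add: mult.assoc)
      qed
      from mult_left_mono[OF this heat_kernel_nonneg[of t "x - y"]] heat_kernel_times_exp[OF t(1), of "x - y"]
      show ?thesis by (simp add: algebra_simps)
    qed
    have int: "integrable lborel (\<lambda>y. (g x - e / 2) * heat_kernel t (x - y)
        - B * E * 2 powr (CARD('n) / 2) * heat_kernel (2 * t) (x - y))"
      using t by (intro Bochner_Integration.integrable_diff integrable_mult_right integrable_heat_kernel) auto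
    have "g x - e \<le> (g x - e / 2) * 1 - B * E * 2 powr (CARD('n) / 2) * 1"
      using \<tau>(2)[OF t] by (simp add: A_def E_def mult_ac)
    also have "\<dots> = (LINT y|lborel. (g x - e / 2) * heat_kernel t (x - y)
        - B * E * 2 powr (CARD('n) / 2) * heat_kernel (2 * t) (x - y))"
      using t by (subst Bochner_Integration.integral_diff)
        (auto intro!: integrable_heat_kernel simp: integral_heat_kernel)
    also have "\<dots> = (LINT y|lebesgue. (g x - e / 2) * heat_kernel t (x - y)
        - B * E * 2 powr (CARD('n) / 2) * heat_kernel (2 * t) (x - y))"
      using int by (simp add: integral_completion borel_measurable_integrable)
    also have "\<dots> \<le> (LINT y|lebesgue. heat_kernel t (x - y) * g y)"
    proof (rule integral_mono[OF _ _ pw])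
      show "integrable lebesgue (\<lambda>y. (g x - e / 2) * heat_kernel t (x - y)
          - B * E * 2 powr (CARD('n) / 2) * heat_kernel (2 * t) (x - y))"
        using int by (simp add: integrable_completion borel_measurable_integrable)
      have "g \<in> borel_measurable lebesgue"
        using borel_measurable_continuous_onI[OF g(1)] by (simp add: measurable_completion)
      then show "integrable lebesgue (\<lambda>y. heat_kernel t (x - y) * g y)"
        using t(1) g(2,3) by (intro integrable_heat_kernel_times_bounded[where B = B]) auto
    qed
    finally show "g x - e \<le> (LINT y|lebesgue. heat_kernel t (x - y) * g y)" .
  qed
qed

text \<open>The nonlinear Duhamel term is nonnegative and the heat kernel preserves order. The
  bounds exclude the origin, a null set, because \<open>v_infty\<close> has a conventional value
  there.\<close>

lemma global_solution_ge_heat_semigroup: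
  fixes w :: "real ^ 'n \<Rightarrow> real \<Rightarrow> real"
  assumes w: "global_solution p w0 w" and "w0 \<in> borel_measurable lebesgue"
    and w0: "\<And>y. y \<noteq> 0 \<Longrightarrow> \<bar>w0 y\<bar> \<le> B"
    and g: "g \<in> borel_measurable lebesgue" "\<And>y. y \<noteq> 0 \<Longrightarrow> 0 \<le> g y \<and> g y \<le> w0 y"
    and t: "t > 0"
  shows "(LINT y|lebesgue. heat_kernel t (x - y) * g y) \<le> w x t"
proof -
  have AE0: "AE y in lebesgue. y \<noteq> (0 :: real ^ 'n)"
    by (rule AE_not_in[of "{0}", simplified]) (simp add: null_sets_completionI)
  have "(LINT y|lebesgue. heat_kernel t (x - y) * g y) \<le> (LINT y|lebesgue. heat_kernel t (x - y) * w0 y)"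
  proof (rule integral_mono_AE)
    show "integrable lebesgue (\<lambda>y. heat_kernel t (x - y) * g y)"
      using AE0 w0 g(2)
      by (intro integrable_heat_kernel_times_bounded[OF t g(1), where B = B]) (force elim: eventually_mono)
    show "integrable lebesgue (\<lambda>y. heat_kernel t (x - y) * w0 y)"
      using AE0 w0
      by (intro integrable_heat_kernel_times_bounded[OF t assms(2), where B = B]) (force elim: eventually_mono)
    show "AE y in lebesgue. heat_kernel t (x - y) * g y \<le> heat_kernel t (x - y) * w0 y"
      using AE0 by eventually_elim (use g(2) in \<open>auto intro!: mult_left_mono simp: heat_kernel_nonneg\<close>)
  qed
  \<comment> \<open>The integrands are nonnegative; a Bochner integral that does not exist has the
    default value 0, which is nonnegative too.\<close>
  moreover have "0 \<le> (LINT s:{0<..<t}|lborel. (LINT y|lborel. heat_kernel (t - s) (x - y) * w y s powr p))"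
    unfolding set_lebesgue_integral_def
    by (auto simp: heat_kernel_nonneg intro!: Bochner_Integration.integral_nonneg mult_nonneg_nonneg)
  ultimately show ?thesis
    using w t by (auto simp: global_solution_def duhamel_def)
qed

section \<open>Convexity, the Hardy operator and the barrier\<close>

text \<open>Convexity on the open half-line, where the power is differentiable; the endpoint
  \<open>u = 0\<close> is checked directly.\<close>

lemma powr_ge_tangent:
  fixes u v p :: real
  assumes "p \<ge> 1" "v > 0" "u \<ge> 0"
  shows "v powr p + p * v powr (p - 1) * (u - v) \<le> u powr p"
proof (cases "u = 0")
  case True
  have "v powr p = v powr (p - 1) * v" using assms by (simp add: powr_mult_base mult.commute)
  moreover have "0 \<le> (p - 1) * v powr p" using assms by simp
  ultimately show ?thesis using True assms by (simp add: algebra_simps)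
next
  case False
  with assms have u: "u > 0" by simp
  have "(\<lambda>x. x powr p) u - (\<lambda>x. x powr p) v \<ge> (p * v powr (p - 1)) * (u - v)"
  proof (rule convex_on_imp_above_tangent[of "{0<..}"])
    show "convex_on {0<..} (\<lambda>x :: real. x powr p)"
      using assms by (intro powr_convex)
    show "((\<lambda>x. x powr p) has_real_derivative p * v powr (p - 1)) (at v within {0<..})"
      using assms by (auto intro!: derivative_eq_intros)
  qed (use assms u in \<open>auto simp: interior_open\<close>)
  then show ?thesis by simp
qed

lemma powr_inner_self: "(x \<bullet> x) powr (r / 2) = norm x powr r"
  by (cases "x = 0") (simp_all add: power2_norm_eq_inner [symmetric] powr_powr flip: powr_numeral)

text \<open>This is \<open>v_infty\<close> as a function of \<open>s = |x|^2\<close>, for which the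
  Laplacian becomes \<open>2 * n\<close> times the first plus \<open>4 * s\<close> times the second
  derivative. The second claim, multiplied by \<open>p\<close>, identifies the Hardy
  potential.\<close>

lemma radial_power_solves_elliptic_equation:
  fixes L m p n s :: real
  assumes "s > 0" "L > 0" "m > 0" "p * m = m + 2" "L powr (p - 1) = m * (n - 2 - m)"
  shows "2 * n * (- (m / 2) * L * s powr (- m / 2 - 1))
      + 4 * s * (m / 2 * (m / 2 + 1) * L * s powr (- m / 2 - 2))
      = - ((L * s powr (- m / 2)) powr p)"
    and "(L * s powr (- m / 2)) powr (p - 1) = m * (n - 2 - m) / s"
proof -
  have e: "- m / 2 * (p - 1) = - 1" using assms(4) by (simp add: field_simps)
  show *: "(L * s powr (- m / 2)) powr (p - 1) = m * (n - 2 - m) / s"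
    unfolding powr_mult powr_powr e assms(5) using assms(1) by (simp add: powr_minus_divide)
  have s1: "s powr (- m / 2 - 1) = s powr (- m / 2) / s"
    using assms(1) by (simp add: powr_diff)
  have s2: "s powr (- m / 2 - 2) = s powr (- m / 2) / s\<^sup>2"
    using assms(1) by (simp add: powr_diff)
  have **: "(L * s powr (- m / 2)) powr p = (L * s powr (- m / 2)) powr (p - 1) * (L * s powr (- m / 2))"
    using assms by (simp add: powr_diff)
  show "2 * n * (- (m / 2) * L * s powr (- m / 2 - 1))
      + 4 * s * (m / 2 * (m / 2 + 1) * L * s powr (- m / 2 - 2))
      = - ((L * s powr (- m / 2)) powr p)"
    unfolding ** * s1 s2 using assms(1) by (simp add: field_simps power2_eq_square)
qed

text \<open>The factors after \<open>S\<close> come from differentiating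
  \<open>s powr (- \<sigma> / 2) * z\<close> once and twice. Terms in \<open>z\<close> cancel
  against the potential, and the first-order terms shift the dimension from \<open>n\<close> to
  \<open>n - 2 * \<sigma>\<close>.\<close>

lemma Hardy_operator_conjugation:
  fixes z z1 z2 \<sigma> n s :: real
  assumes "s > 0"
  defines "S \<equiv> s powr (- \<sigma> / 2)"
  shows "2 * n * (S * (z1 - \<sigma> / 2 * z / s))
      + 4 * s * (S * (z2 - \<sigma> * z1 / s + \<sigma> / 2 * (\<sigma> / 2 + 1) * z / s\<^sup>2))
      + \<sigma> * (n - 2 - \<sigma>) / s * (S * z)
      = S * (2 * (n - 2 * \<sigma>) * z1 + 4 * s * z2)"
  using assms(1) by (simp add: field_simps power2_eq_square)

lemma Hardy_barrier_derivatives: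
  fixes z z1 :: "real \<Rightarrow> real"
  assumes "s > 0" "(z has_real_derivative z1 s) (at s)" "(z1 has_real_derivative z2) (at s)"
  shows "((\<lambda>s. s powr (- \<sigma> / 2) * z s) has_real_derivative
      s powr (- \<sigma> / 2) * (z1 s - \<sigma> / 2 * z s / s)) (at s)"
    and "((\<lambda>s. s powr (- \<sigma> / 2) * (z1 s - \<sigma> / 2 * z s / s)) has_real_derivative
      s powr (- \<sigma> / 2) * (z2 - \<sigma> * z1 s / s + \<sigma> / 2 * (\<sigma> / 2 + 1) * z s / s\<^sup>2)) (at s)"
proof -
  have s1: "s powr (- \<sigma> / 2 - 1) = s powr (- \<sigma> / 2) / s"
    using assms(1) by (simp add: powr_diff)
  show "((\<lambda>s. s powr (- \<sigma> / 2) * z s) has_real_derivative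
      s powr (- \<sigma> / 2) * (z1 s - \<sigma> / 2 * z s / s)) (at s)"
    by (rule derivative_eq_intros assms refl)+ (use assms(1) s1 in \<open>simp add: field_simps\<close>)
  show "((\<lambda>s. s powr (- \<sigma> / 2) * (z1 s - \<sigma> / 2 * z s / s)) has_real_derivative
      s powr (- \<sigma> / 2) * (z2 - \<sigma> * z1 s / s + \<sigma> / 2 * (\<sigma> / 2 + 1) * z s / s\<^sup>2)) (at s)"
  proof (rule DERIV_mult'[THEN DERIV_cong])
    show "((\<lambda>s. s powr (- \<sigma> / 2)) has_real_derivative - \<sigma> / 2 * s powr (- \<sigma> / 2 - 1)) (at s)"
      using assms(1) by (auto intro!: derivative_eq_intros)
    have "((\<lambda>s. \<sigma> / 2 * z s / s) has_real_derivative \<sigma> / 2 * (z1 s * s - z s) / s\<^sup>2) (at s)"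
      by (rule derivative_eq_intros assms(2) refl)+
        (use assms(1) in \<open>auto simp: field_simps power2_eq_square\<close>)
    then show "((\<lambda>s. z1 s - \<sigma> / 2 * z s / s) has_real_derivative
        z2 - \<sigma> / 2 * (z1 s * s - z s) / s\<^sup>2) (at s)"
      by (rule DERIV_diff[OF assms(3)])
  qed (use assms(1) in \<open>unfold s1, simp add: field_simps power2_eq_square\<close>)
qed

text \<open>In the variable \<open>y = s / (1 + t)\<close> the heat inequality for the first summand
  is \<open>sup\<close>. The second summand makes it strict: its Laplacian is at most
  \<open>2 * d * j + 4 * j\<^sup>2\<close> times itself, which the growth rate \<open>K\<close>
  exceeds.\<close>

lemma selfsimilar_plus_growing_strict_supersolution:
  fixes F F1 F2 :: "real \<Rightarrow> real" and a d C e j K :: real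
  assumes F: "\<And>y. y > 0 \<Longrightarrow> (F has_real_derivative F1 y) (at y)"
    and F1: "\<And>y. y > 0 \<Longrightarrow> (F1 has_real_derivative F2 y) (at y)"
    and sup: "\<And>y. y > 0 \<Longrightarrow> 4 * y * F2 y + (2 * d + y) * F1 y + a * F y \<le> 0"
    and pos: "C \<ge> 0" "e > 0" "j > 0" "d > 0" "K > 2 * d * j + 4 * j\<^sup>2"
  defines "z \<equiv> \<lambda>s t. C * (1 + t) powr (- a) * F (s / (1 + t)) + e * (1 + s) powr j * exp (K * t)"
  obtains zt z1 z2 where
    "\<And>s t. s > 0 \<Longrightarrow> t > 0 \<Longrightarrow> ((\<lambda>t. z s t) has_real_derivative zt s t) (at t)"
    "\<And>s t. s > 0 \<Longrightarrow> t > 0 \<Longrightarrow> ((\<lambda>s. z s t) has_real_derivative z1 s t) (at s)"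
    "\<And>s t. s > 0 \<Longrightarrow> t > 0 \<Longrightarrow> ((\<lambda>s. z1 s t) has_real_derivative z2 s t) (at s)"
    "\<And>s t. s > 0 \<Longrightarrow> t > 0 \<Longrightarrow> 2 * d * z1 s t + 4 * s * z2 s t < zt s t"
proof -
  define zt where "zt = (\<lambda>s t. - C * (1 + t) powr (- a - 1) * (a * F (s / (1 + t)) + s / (1 + t) * F1 (s / (1 + t)))
    + e * (1 + s) powr j * (K * exp (K * t)))"
  define z1 where "z1 = (\<lambda>s t. C * (1 + t) powr (- a - 1) * F1 (s / (1 + t))
    + e * (j * (1 + s) powr (j - 1)) * exp (K * t))"
  define z2 where "z2 = (\<lambda>s t. C * (1 + t) powr (- a - 2) * F2 (s / (1 + t))
    + e * (j * (j - 1) * (1 + s) powr (j - 2)) * exp (K * t))"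
  show thesis
  proof (rule that)
    fix s t :: real assume st: "s > 0" "t > 0"
    have y: "s / (1 + t) > 0" using st by simp
    have p1: "(1 + t) powr (- a - 1) = (1 + t) powr (- a) / (1 + t)"
      "(1 + t) powr (- a - 2) = (1 + t) powr (- a) / (1 + t)\<^sup>2"
      using st by (simp_all add: powr_diff)
    have yt: "((\<lambda>t. s / (1 + t)) has_real_derivative - s / (1 + t)\<^sup>2) (at t)"
      using st by (auto intro!: derivative_eq_intros simp: power2_eq_square)
    have ys: "((\<lambda>s. s / (1 + t)) has_real_derivative 1 / (1 + t)) (at s)"
      using st by (auto intro!: derivative_eq_intros)
    define A where "A = 1 + t"
    have A: "A > 0" using st by (simp add: A_def)
    have pA: "A * A powr (- a - 1) = A powr - a" "A * A powr (- a - 2) = A powr (- a - 1)"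
      using A by (simp_all add: powr_diff power2_eq_square)
    have pt: "((\<lambda>t. (1 + t) powr - a) has_real_derivative - a * (1 + t) powr (- a - 1)) (at t)"
      using st by (auto intro!: derivative_eq_intros)
    have et: "((\<lambda>t. exp (K * t)) has_real_derivative K * exp (K * t)) (at t)"
      by (auto intro!: derivative_eq_intros)
    have ps: "((\<lambda>s. (1 + s) powr r) has_real_derivative r * (1 + s) powr (r - 1)) (at s)" for r
      using st by (auto intro!: derivative_eq_intros)
    show "((\<lambda>t. z s t) has_real_derivative zt s t) (at t)"
      unfolding z_def zt_def
      by (rule DERIV_cong[OF DERIV_add[OF DERIV_mult'[OF DERIV_cmult[OF pt] DERIV_chain2[OF F[OF y] yt]]
              DERIV_cmult[OF et]]])
        (use st A in \<open>unfold A_def [symmetric], simp add: pA field_simps power2_eq_square\<close>)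
    show "((\<lambda>s. z s t) has_real_derivative z1 s t) (at s)"
      unfolding z_def z1_def
      by (rule DERIV_cong[OF DERIV_add[OF DERIV_cmult[OF DERIV_chain2[OF F[OF y] ys]]
              DERIV_cmult_right[OF DERIV_cmult[OF ps]]]])
        (use st in \<open>unfold p1, simp add: field_simps\<close>)
    have "((\<lambda>s. j * (1 + s) powr (j - 1)) has_real_derivative j * (j - 1) * (1 + s) powr (j - 2)) (at s)"
      by (rule DERIV_cong[OF DERIV_cmult[OF ps]]) simp
    then show "((\<lambda>s. z1 s t) has_real_derivative z2 s t) (at s)"
      unfolding z1_def z2_def
      by (rule DERIV_cong[OF DERIV_add[OF DERIV_cmult[OF DERIV_chain2[OF F1[OF y] ys]]
              DERIV_cmult_right[OF DERIV_cmult]]])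
        (use st A in \<open>unfold A_def [symmetric], simp add: pA field_simps power2_eq_square\<close>)
    define v where "v = 1 + s"
    define P where "P = v powr (j - 2)"
    have v: "v > 1" "s = v - 1" using st by (auto simp: v_def)
    have P0: "P > 0" using v by (simp add: P_def)
    have Pj: "v powr (j - 1) = v * P" "v powr j = v\<^sup>2 * P"
      using v by (simp_all add: P_def powr_diff field_simps power2_eq_square)
    have "2 * d * z1 s t + 4 * s * z2 s t - zt s t =
        C * (1 + t) powr (- a - 1) * (4 * (s / (1 + t)) * F2 (s / (1 + t))
          + (2 * d + s / (1 + t)) * F1 (s / (1 + t)) + a * F (s / (1 + t)))
        + e * exp (K * t) * P * (2 * d * j * v + 4 * s * j * (j - 1) - K * v\<^sup>2)"
    proof -
      have "(1 + t) powr (- a - 2) * (4 * s) = (1 + t) powr (- a - 1) * (4 * (s / (1 + t)))"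
        using st by (simp add: p1 power2_eq_square)
      then have "4 * s * (C * (1 + t) powr (- a - 2) * F2 (s / (1 + t)))
          = C * (1 + t) powr (- a - 1) * (4 * (s / (1 + t)) * F2 (s / (1 + t)))"
        by (simp add: algebra_simps)
      moreover have "2 * d * (e * (j * (v * P)) * exp (K * t))
          + 4 * s * (e * (j * (j - 1) * P) * exp (K * t)) - e * (v\<^sup>2 * P) * (K * exp (K * t))
          = e * exp (K * t) * P * (2 * d * j * v + 4 * s * j * (j - 1) - K * v\<^sup>2)"
        by (simp add: algebra_simps)
      ultimately show ?thesis
        unfolding z1_def z2_def zt_def v_def [symmetric] Pj P_def [symmetric]
        by (simp add: algebra_simps)
    qed
    also have "\<dots> < 0"
    proof (rule add_nonpos_neg)
      show "C * (1 + t) powr (- a - 1) * (4 * (s / (1 + t)) * F2 (s / (1 + t))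
          + (2 * d + s / (1 + t)) * F1 (s / (1 + t)) + a * F (s / (1 + t))) \<le> 0"
        using sup[OF y] pos by (intro mult_nonneg_nonpos) auto
      have "v \<le> v\<^sup>2" using v by (simp add: power2_eq_square)
      then have "2 * d * j * v \<le> 2 * d * j * v\<^sup>2" using pos by (intro mult_left_mono) auto
      moreover have "4 * s * j * (j - 1) \<le> 4 * v\<^sup>2 * j * j"
        using pos v \<open>v \<le> v\<^sup>2\<close> by (intro mult_mono order_trans[OF mult_left_mono[of "j - 1" j "4 * s * j"] mult_right_mono]) auto
      moreover have "0 < (K - (2 * d * j + 4 * j\<^sup>2)) * v\<^sup>2" using pos v by simp
      ultimately have "2 * d * j * v + 4 * s * j * (j - 1) - K * v\<^sup>2 < 0"
        by (simp add: algebra_simps power2_eq_square)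
      then show "e * exp (K * t) * P * (2 * d * j * v + 4 * s * j * (j - 1) - K * v\<^sup>2) < 0"
        using pos P0 by (intro mult_pos_neg) auto
    qed
    finally show "2 * d * z1 s t + 4 * s * z2 s t < zt s t" by simp
  qed
qed

section \<open>Comparison of a classical solution with the barrier\<close>

text \<open>The function \<open>V\<close> minus the barrier is a strict subsolution wherever it is
  nonnegative. The hypothesis \<open>init\<close> replaces an ordering at time zero by one for small
  times, uniform on balls and with slack \<open>e\<close>, since the datum need not be
  continuous.\<close>

lemma singular_solution_minus_solution_upper_bound:
  fixes w :: "real ^ 'n \<Rightarrow> real \<Rightarrow> real" and p m \<sigma> a L C :: real and F F1 F2 :: "real \<Rightarrow> real"
  defines "V \<equiv> \<lambda>s. L * s powr (- m / 2)" and "d \<equiv> real CARD('n) - 2 * \<sigma>"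
  assumes w: "classical_heat_power p w" "\<And>x t. t > 0 \<Longrightarrow> 0 \<le> w x t"
    and par: "p > 1" "m > 0" "m < \<sigma>" "d > 0" "p * m = m + 2" "a > 0" "C \<ge> 0"
    and L: "L > 0" "L powr (p - 1) = m * (real CARD('n) - 2 - m)"
    and \<sigma>: "\<sigma> * (real CARD('n) - 2 - \<sigma>) = p * (m * (real CARD('n) - 2 - m))"
    and F: "\<And>y. y > 0 \<Longrightarrow> (F has_real_derivative F1 y) (at y)"
    and F1: "\<And>y. y > 0 \<Longrightarrow> (F1 has_real_derivative F2 y) (at y)"
    and sup: "\<And>y. y > 0 \<Longrightarrow> 4 * y * F2 y + (2 * d + y) * F1 y + a * F y \<le> 0"
    and F_ge: "\<And>y. y > 0 \<Longrightarrow> (1 + y) powr (- a) \<le> F y"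
    and init: "\<And>e R. e > 0 \<Longrightarrow> \<exists>\<tau>>0. \<forall>x t. x \<noteq> 0 \<longrightarrow> norm x \<le> R \<longrightarrow> 0 < t \<longrightarrow> t < \<tau> \<longrightarrow>
       V (x \<bullet> x) - C * (x \<bullet> x) powr (- \<sigma> / 2) * (1 + x \<bullet> x) powr (- a) - e \<le> w x t"
    and xt: "x \<noteq> 0" "t > 0"
  shows "V (x \<bullet> x) - 2 powr a * C * (x \<bullet> x) powr (- \<sigma> / 2) * (1 + t) powr (- a) * F (x \<bullet> x / (1 + t))
     \<le> w x t"
proof -
  \<comment> \<open>With this exponent the correction
    \<open>e * s powr (- \<sigma> / 2) * (1 + s) powr j\<close> is at least \<open>e\<close>
    everywhere and at least \<open>e * |x|^(-sigma)\<close>.\<close>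
  define j where "j = \<sigma> / 2"
  define K where "K = 2 * d * j + 4 * j\<^sup>2 + 1"
  define C0 where "C0 = 2 powr a * C"
  have j: "j > 0" using par by (simp add: j_def)
  have C0: "C0 \<ge> 0" using par by (simp add: C0_def)
  have K: "K > 2 * d * j + 4 * j\<^sup>2" by (simp add: K_def)
  have F_pos: "F y > 0" if "y > 0" for y
    by (rule less_le_trans[OF _ F_ge[OF that]]) (use that in simp)
  have approx: "V (x \<bullet> x) - (x \<bullet> x) powr (- \<sigma> / 2) *
      (C0 * (1 + t) powr (- a) * F (x \<bullet> x / (1 + t)) + e * (1 + x \<bullet> x) powr j * exp (K * t)) < w x t"
    if e: "e > 0" for e
  proof -
    define z where "z = (\<lambda>s t. C0 * (1 + t) powr (- a) * F (s / (1 + t)) + e * (1 + s) powr j * exp (K * t))"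
    obtain zt z1 z2 where z:
      "\<And>s t. s > 0 \<Longrightarrow> t > 0 \<Longrightarrow> ((\<lambda>t. z s t) has_real_derivative zt s t) (at t)"
      "\<And>s t. s > 0 \<Longrightarrow> t > 0 \<Longrightarrow> ((\<lambda>s. z s t) has_real_derivative z1 s t) (at s)"
      "\<And>s t. s > 0 \<Longrightarrow> t > 0 \<Longrightarrow> ((\<lambda>s. z1 s t) has_real_derivative z2 s t) (at s)"
      "\<And>s t. s > 0 \<Longrightarrow> t > 0 \<Longrightarrow> 2 * d * z1 s t + 4 * s * z2 s t < zt s t"
      by (rule selfsimilar_plus_growing_strict_supersolution[OF F F1 sup C0 e j par(4) K])
        (assumption | rule that; unfold z_def; assumption)+
    have z_ge: "e * (1 + s) powr j \<le> z s t"
      "C0 * (1 + t) powr (- a) * F (s / (1 + t)) + e * (1 + s) powr j \<le> z s t"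
      if "s > 0" "t > 0" for s t
    proof -
      have "0 \<le> 2 * d * j + 4 * j\<^sup>2" using j par by simp
      then have "0 < K" using K by linarith
      then have "1 \<le> exp (K * t)" using that by simp
      then have "e * (1 + s) powr j * 1 \<le> e * (1 + s) powr j * exp (K * t)"
        using e by (intro mult_left_mono) auto
      moreover have "0 \<le> C0 * (1 + t) powr (- a) * F (s / (1 + t))"
        using C0 that F_pos[of "s / (1 + t)"] by simp
      ultimately show "e * (1 + s) powr j \<le> z s t"
        "C0 * (1 + t) powr (- a) * F (s / (1 + t)) + e * (1 + s) powr j \<le> z s t"
        by (simp_all add: z_def)
    qed
    have S_ge: "1 \<le> s powr (- \<sigma> / 2) * (1 + s) powr j" if "s > 0" for s
    proof -
      have "s powr (- \<sigma> / 2) * s powr j \<le> s powr (- \<sigma> / 2) * (1 + s) powr j"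
        using that j by (intro mult_left_mono powr_mono2) auto
      then show ?thesis using that by (simp add: j_def flip: powr_add)
    qed
    define q where "q = (\<lambda>s t. V s - s powr (- \<sigma> / 2) * z s t)"
    \<comment> \<open>The radii solve \<open>L * r powr (- m) = e * r powr (- \<sigma>)\<close> and
      \<open>L * r powr (- m) = e\<close>. Below the first and above the second the correction
      exceeds \<open>V\<close>, so \<open>q\<close> is negative there.\<close>
    define r1 where "r1 = (e / L) powr (1 / (\<sigma> - m))"
    define r2 where "r2 = (L / e) powr (1 / m)"
    \<comment> \<open>Using half of \<open>e\<close> leaves a strict inequality, because the
      correction contributes at least \<open>e\<close>.\<close>
    obtain \<tau>0 where \<tau>0: "\<tau>0 > 0" "\<And>x t. x \<noteq> 0 \<Longrightarrow> norm x \<le> r2 \<Longrightarrow> 0 < t \<Longrightarrow> t < \<tau>0 \<Longrightarrow>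
        V (x \<bullet> x) - C * (x \<bullet> x) powr (- \<sigma> / 2) * (1 + x \<bullet> x) powr (- a) - e / 2 \<le> w x t"
      using init[of "e / 2" r2] e by auto
    define \<tau> where "\<tau> = min \<tau>0 1"
    have "q (x \<bullet> x) t < w x t"
    proof (rule radial_strict_subsolution_less[OF w, where T = t and ?r1.0 = r1 and ?r2.0 = r2 and \<tau> = \<tau>])
      show "continuous_on ({0<..} \<times> {0<..}) (\<lambda>(s, t). q s t)"
      proof -
        have "continuous_on {0<..} F"
          using F by (intro DERIV_continuous_on[of _ _ F1]) (auto intro: has_field_derivative_at_within)
        then have "continuous_on ({0<..} \<times> {0<..}) (\<lambda>z. F (fst z / (1 + snd z)))"
          by (rule continuous_on_compose2) (auto intro!: continuous_intros)
        then show ?thesis unfolding q_def z_def V_def case_prod_beta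
          by (auto intro!: continuous_intros)
      qed
    next
      fix s t :: real assume st: "s > 0" "t > 0"
      show "((\<lambda>t. q s t) has_real_derivative - (s powr (- \<sigma> / 2) * zt s t)) (at t)"
        unfolding q_def by (rule DERIV_cong[OF DERIV_diff[OF DERIV_const DERIV_cmult[OF z(1)[OF st]]]]) simp
      define B1 where "B1 = (\<lambda>s t. s powr (- \<sigma> / 2) * (z1 s t - \<sigma> / 2 * z s t / s))"
      define B2 where "B2 = (\<lambda>s t. s powr (- \<sigma> / 2) *
          (z2 s t - \<sigma> * z1 s t / s + \<sigma> / 2 * (\<sigma> / 2 + 1) * z s t / s\<^sup>2))"
      define V1 where "V1 = (\<lambda>s. - (m / 2) * L * s powr (- m / 2 - 1))"
      define V2 where "V2 = (\<lambda>s. m / 2 * (m / 2 + 1) * L * s powr (- m / 2 - 2))"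
      note BD = Hardy_barrier_derivatives[OF st(1) z(2)[OF st] z(3)[OF st], of \<sigma>]
      have V': "(V has_real_derivative V1 s) (at s)"
        unfolding V_def V1_def using st by (auto intro!: derivative_eq_intros)
      have V'': "(V1 has_real_derivative V2 s) (at s)"
        unfolding V1_def V2_def using st
        by (auto intro!: derivative_eq_intros simp: field_simps)
      show "((\<lambda>s. q s t) has_real_derivative V1 s - B1 s t) (at s)"
        unfolding q_def B1_def by (rule DERIV_diff[OF V' BD(1)])
      show "((\<lambda>s. V1 s - B1 s t) has_real_derivative V2 s - B2 s t) (at s)"
        unfolding B1_def B2_def by (rule DERIV_diff[OF V'' BD(2)])
      assume q0: "q s t \<ge> 0"
      define S where "S = s powr (- \<sigma> / 2)"
      have S0: "S > 0" using st by (simp add: S_def)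
      have V0: "V s > 0" using st L by (simp add: V_def)
      note ell = radial_power_solves_elliptic_equation[OF st(1) L(1) par(2,5) L(2)]
      \<comment> \<open>The tangent at \<open>V s\<close> linearizes the nonlinearity. Its slope is
        the Hardy potential, so the conjugation identity absorbs the linear term, and the equation
        for \<open>V\<close> absorbs \<open>V s powr p\<close>.\<close>
      have "V s powr p + p * V s powr (p - 1) * (q s t - V s) \<le> q s t powr p"
        using par V0 q0 by (intro powr_ge_tangent) auto
      moreover have "p * V s powr (p - 1) = \<sigma> * (real CARD('n) - 2 - \<sigma>) / s"
        unfolding V_def ell(2) \<sigma> by simp
      ultimately have 1: "V s powr p - \<sigma> * (real CARD('n) - 2 - \<sigma>) / s * (S * z s t) \<le> q s t powr p"
        by (simp add: q_def S_def)
      have 2: "2 * real CARD('n) * V1 s + 4 * s * V2 s = - (V s powr p)"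
        unfolding V1_def V2_def V_def by (rule ell(1))
      have 3: "2 * real CARD('n) * B1 s t + 4 * s * B2 s t
          + \<sigma> * (real CARD('n) - 2 - \<sigma>) / s * (S * z s t) = S * (2 * d * z1 s t + 4 * s * z2 s t)"
        unfolding B1_def B2_def S_def d_def by (rule Hardy_operator_conjugation[OF st(1)])
      have "S * (2 * d * z1 s t + 4 * s * z2 s t) < S * zt s t"
        using z(4)[OF st] S0 by simp
      with 1 2 3 show "- (s powr (- \<sigma> / 2) * zt s t)
          < 2 * real CARD('n) * (V1 s - B1 s t) + 4 * s * (V2 s - B2 s t) + q s t powr p"
        unfolding S_def [symmetric] right_diff_distrib by linarith
    next
      show "0 < r1" "0 < \<tau>" using e L \<tau>0 by (auto simp: r1_def \<tau>_def)
      fix x :: "real ^ 'n" and t :: real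
      assume x: "x \<noteq> 0" and t: "0 < t"
        and cases: "norm x < r1 \<or> norm x > r2 \<or> t < \<tau>"
      define s where "s = x \<bullet> x"
      define r where "r = norm x"
      have s: "s > 0" and r: "r > 0" using x by (auto simp: s_def r_def)
      have Vr: "V s = L * r powr (- m)"
        unfolding V_def s_def r_def by (simp only: powr_inner_self)
      have Sr: "s powr (- \<sigma> / 2) = r powr (- \<sigma>)"
        unfolding s_def r_def by (simp only: powr_inner_self)
      have S0: "s powr (- \<sigma> / 2) > 0" using s by simp
      have b1: "e * r powr (- \<sigma>) \<le> s powr (- \<sigma> / 2) * z s t"
      proof -
        have "e * 1 \<le> e * (1 + s) powr j" using s j e by (intro mult_left_mono ge_one_powr_ge_zero) auto
        also have "\<dots> \<le> z s t" by (rule z_ge(1)[OF s t])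
        finally show ?thesis using S0 unfolding Sr by (simp add: mult.commute)
      qed
      have b2: "s powr (- \<sigma> / 2) * (C0 * (1 + t) powr (- a) * F (s / (1 + t))) + e \<le> s powr (- \<sigma> / 2) * z s t"
      proof -
        have "e * 1 \<le> e * (s powr (- \<sigma> / 2) * (1 + s) powr j)"
          using e by (intro mult_left_mono S_ge[OF s]) auto
        moreover have "s powr (- \<sigma> / 2) * (C0 * (1 + t) powr (- a) * F (s / (1 + t)) + e * (1 + s) powr j)
            \<le> s powr (- \<sigma> / 2) * z s t"
          by (intro mult_left_mono z_ge(2)[OF s t]) auto
        ultimately show ?thesis by (simp add: algebra_simps)
      qed
      have b3: "0 \<le> s powr (- \<sigma> / 2) * (C0 * (1 + t) powr (- a) * F (s / (1 + t)))"
        using C0 F_pos[of "s / (1 + t)"] s t by simp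
      consider "r < r1" | "r > r2" | "r \<le> r2" "t < \<tau>" using cases unfolding r_def by linarith
      then have "q s t < w x t"
      proof cases
        case 1
        have "r powr (\<sigma> - m) < r1 powr (\<sigma> - m)"
          using 1 r par by (intro powr_less_mono2) auto
        also have "\<dots> = e / L" using par e L by (simp add: r1_def powr_powr)
        finally have "L * r powr (\<sigma> - m) * r powr (- \<sigma>) < e * r powr (- \<sigma>)"
          using L r by (simp add: field_simps)
        then have "V s < e * r powr (- \<sigma>)"
          by (simp add: Vr mult.assoc flip: powr_add)
        then have "q s t < 0" using b1 by (simp add: q_def)
        with w(2)[OF t, of x] show ?thesis by linarith
      next
        case 2
        have "r2 powr m < r powr m"
          using 2 par by (intro powr_less_mono2) (auto simp: r2_def)
        moreover have "r2 powr m = L / e" using par e L by (simp add: r2_def powr_powr)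
        ultimately have "L * r powr (- m) < e"
          using e r by (simp add: powr_minus field_simps)
        then have "q s t < 0" using b2 b3 by (simp add: q_def Vr)
        with w(2)[OF t, of x] show ?thesis by linarith
      next
        case 3
        have "V s - C * s powr (- \<sigma> / 2) * (1 + s) powr (- a) - e / 2 \<le> w x t"
          using \<tau>0(2)[OF x _ t] 3 by (simp add: s_def r_def \<tau>_def)
        moreover have "C * s powr (- \<sigma> / 2) * (1 + s) powr (- a)
            \<le> s powr (- \<sigma> / 2) * (C0 * (1 + t) powr (- a) * F (s / (1 + t)))"
        proof -
          \<comment> \<open>For \<open>t < \<tau> \<le> 1\<close> one has
            \<open>1 + t + s \<le> 2 * (1 + s)\<close>; this is where the factor
            \<open>2 powr a\<close> in \<open>C0\<close> comes from.\<close>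
          have "2 powr (- a) * (1 + s) powr (- a) = (2 * (1 + s)) powr (- a)"
            by (rule powr_mult [symmetric])
          also have "\<dots> \<le> (1 + t + s) powr (- a)"
            using 3 s t par by (intro powr_mono2') (auto simp: \<tau>_def)
          also have "\<dots> = ((1 + t) * (1 + s / (1 + t))) powr (- a)"
            using t by (simp add: distrib_left)
          also have "\<dots> = (1 + t) powr (- a) * (1 + s / (1 + t)) powr (- a)"
            using s t by (intro powr_mult)
          also have "\<dots> \<le> (1 + t) powr (- a) * F (s / (1 + t))"
            using s t by (intro mult_left_mono F_ge) auto
          finally have "C0 * (2 powr (- a) * (1 + s) powr (- a)) \<le> C0 * ((1 + t) powr (- a) * F (s / (1 + t)))"
            using C0 by (intro mult_left_mono)
          moreover have "C0 * (2 powr (- a) * (1 + s) powr (- a)) = C * (1 + s) powr (- a)"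
            by (simp add: C0_def powr_minus)
          ultimately have "s powr (- \<sigma> / 2) * (C * (1 + s) powr (- a))
              \<le> s powr (- \<sigma> / 2) * (C0 * ((1 + t) powr (- a) * F (s / (1 + t))))"
            by (intro mult_left_mono) auto
          then show ?thesis by (simp add: mult_ac)
        qed
        ultimately show ?thesis using b2 e by (simp add: q_def)
      qed
      then show "q (x \<bullet> x) t < w x t" by (simp add: s_def)
    qed (use xt in auto)
    then show ?thesis by (simp add: q_def z_def)
  qed
  \<comment> \<open>Letting \<open>e\<close> tend to 0 removes the correction, at the price of a
    non-strict inequality.\<close>
  have "((\<lambda>e. V (x \<bullet> x) - (x \<bullet> x) powr (- \<sigma> / 2) *
      (C0 * (1 + t) powr (- a) * F (x \<bullet> x / (1 + t)) + e * (1 + x \<bullet> x) powr j * exp (K * t))) \<longlongrightarrow>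
      V (x \<bullet> x) - (x \<bullet> x) powr (- \<sigma> / 2) *
      (C0 * (1 + t) powr (- a) * F (x \<bullet> x / (1 + t)) + 0 * (1 + x \<bullet> x) powr j * exp (K * t))) (at_right 0)"
    by (intro tendsto_intros)
  then have "V (x \<bullet> x) - (x \<bullet> x) powr (- \<sigma> / 2) *
      (C0 * (1 + t) powr (- a) * F (x \<bullet> x / (1 + t)) + 0 * (1 + x \<bullet> x) powr j * exp (K * t)) \<le> w x t"
    by (rule tendsto_upperbound[OF _ eventually_mono[OF eventually_at_right_less less_imp_le[OF approx]]])
      simp_all
  then show ?thesis by (simp add: C0_def mult_ac)
qed

section \<open>Decay estimates for the limit solution\<close>

theorem theorem2p1:
  fixes p b l :: real
    and u0 :: "real ^ 'n \<Rightarrow> real"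
    and u :: "real ^ 'n \<Rightarrow> real \<Rightarrow> real"
  assumes "CARD('n) \<ge> 11"
    and "p \<ge> p_JL CARD('n)"
    and "u0 \<in> borel_measurable lebesgue"
    and "\<And>x. x \<noteq> 0 \<Longrightarrow> 0 \<le> u0 x \<and> u0 x \<le> v_infty p x"
    and "limit_solution p u0 u"
    and "b > 0"
    and "l \<in> {sigma_exp CARD('n) p <..< real CARD('n) - sigma_exp CARD('n) p}"
    and "\<And>x. norm x \<ge> 1 \<Longrightarrow> v_infty p x - b * norm x powr (- l) \<le> u0 x"
  shows "\<exists>C>0. \<forall>t\<ge>1.
     (SUP x\<in>{x. x \<noteq> 0 \<and> norm x \<le> sqrt t}.
        ereal (norm x powr sigma_exp CARD('n) p * (v_infty p x - u x t)))
       \<le> ereal (C * t powr (- ((l - sigma_exp CARD('n) p) / 2))) \<and>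
     (SUP x\<in>{x. x \<noteq> 0 \<and> norm x \<ge> sqrt t}. ereal (v_infty p x - u x t))
       \<le> ereal (C * t powr (- (l / 2)))"
proof -
  define m where "m = 2 / (p - 1)"
  define \<sigma> where "\<sigma> = sigma_exp CARD('n) p"
  define L where "L = L_const CARD('n) p"
  define d where "d = real CARD('n) - 2 * \<sigma>"
  define a where "a = (l - \<sigma>) / 2"
  have p1: "p > 1" by (rule p_JL_gt_one_and_singular_exponent_bound(1)[OF assms(1,2)])
  note props = sigma_exp_properties[OF assms(1,2), folded m_def \<sigma>_def]
  have pm: "p * m = m + 2" using p1 by (simp add: m_def field_simps)
  \<comment> \<open>The upper bound on \<open>l\<close> is exactly \<open>2 * a < d\<close>: the
    rate t^(-a) is slower than that of the heat kernel in dimension \<open>d\<close>.\<close>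
  have a: "0 < a" "2 * a < d" using assms(7) by (auto simp: a_def d_def \<sigma>_def [symmetric])
  have d: "1 \<le> d" "d > 0" using props(4) by (auto simp: d_def)
  have mm: "m * (real CARD('n) - 2 - m) > 0" using props(1,2) by simp
  have L: "L > 0" "L powr (p - 1) = m * (real CARD('n) - 2 - m)"
    using mm p1 props(1,2) by (simp_all add: L_def L_const_def m_def [symmetric] powr_powr)
  define V where "V = (\<lambda>s. L * s powr (- m / 2))"
  have v: "v_infty p x = V (x \<bullet> x)" for x :: "real ^ 'n"
    by (simp only: v_infty_def V_def powr_inner_self L_def m_def) simp
  \<comment> \<open>The summand \<open>b\<close> serves the lower bound on the datum outside the
    unit ball and \<open>L\<close> covers \<open>V\<close> inside it. The factor
    \<open>2 powr a\<close> bounds \<open>s powr (- a)\<close> for \<open>s \<ge> 1\<close>, and 1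
    for \<open>s \<le> 1\<close>, by a multiple of \<open>(1 + s) powr (- a)\<close>.\<close>
  define C1 where "C1 = 2 powr a * (b + L)"
  have C1: "C1 > 0" using L assms(6) by (simp add: C1_def)
  \<comment> \<open>A bounded continuous minorant of the datum. Freezing the argument at 1 avoids
    the singularity, and since the bracket equals \<open>- b\<close> there, the positive part
    vanishes on the unit ball.\<close>
  define G where "G = (\<lambda>s. max 0 (L * max s 1 powr (- m / 2)
      - C1 * max s 1 powr (- \<sigma> / 2) * (1 + max s 1) powr (- a)))"
  define g where "g = (\<lambda>x :: real ^ 'n. G (x \<bullet> x))"
  have g_cont: "continuous_on UNIV g"
    unfolding g_def G_def by (intro continuous_intros) (auto simp: max_def)
  have g_nonneg: "0 \<le> g x" for x by (simp add: g_def G_def)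
  have g_le: "g x \<le> L" for x
  proof -
    have "max s 1 powr (- m / 2) \<le> 1" for s :: real
    proof -
      have "max s 1 powr (- m / 2) \<le> max s 1 powr 0"
        using props(1) by (intro powr_mono) auto
      moreover have "max s 1 \<noteq> 0" by linarith
      ultimately show ?thesis by simp
    qed
    then have "L * max s 1 powr (- m / 2) \<le> L * 1" for s :: real
      using L by (intro mult_left_mono) auto
    moreover have "0 \<le> C1 * max s 1 powr (- \<sigma> / 2) * (1 + max s 1) powr (- a)" for s :: real
      using C1 by simp
    ultimately show ?thesis using L unfolding g_def G_def
      by (smt (verit))
  qed
  have two_a: "1 \<le> 2 powr a * ((1 + s) powr (- a))" if "0 < s" "s \<le> 1" for s :: real
  proof -
    have "2 powr (- a) \<le> (1 + s) powr (- a)" using that a by (intro powr_mono2') auto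
    then have "2 powr a * 2 powr (- a) \<le> 2 powr a * ((1 + s) powr (- a))"
      by (intro mult_left_mono) auto
    then show ?thesis by (simp flip: powr_add)
  qed
  \<comment> \<open>Inside the unit ball the left side is not positive, because
    \<open>m < \<sigma>\<close> gives \<open>V s \<le> L * s powr (- \<sigma> / 2)\<close>
    there.\<close>
  have g_ge: "V (x \<bullet> x) - C1 * (x \<bullet> x) powr (- \<sigma> / 2) * (1 + x \<bullet> x) powr (- a) \<le> g x"
    if "x \<noteq> 0" for x
  proof (cases "x \<bullet> x \<ge> 1")
    case True
    then show ?thesis by (simp add: g_def G_def V_def max_absorb1)
  next
    case False
    define s where "s = x \<bullet> x"
    have s: "0 < s" "s \<le> 1" using False that by (auto simp: s_def)
    have "V s \<le> L * s powr (- \<sigma> / 2)"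
      unfolding V_def using s L props(3) by (intro mult_left_mono powr_mono') auto
    also have "\<dots> \<le> (b + L) * s powr (- \<sigma> / 2) * 1"
      using assms(6) by (simp add: mult_right_mono)
    also have "\<dots> \<le> (b + L) * s powr (- \<sigma> / 2) * (2 powr a * (1 + s) powr (- a))"
      using assms(6) L by (intro mult_left_mono two_a s) auto
    finally show ?thesis using g_nonneg[of x] by (simp add: s_def C1_def mult_ac)
  qed
  have g_le_u0: "g x \<le> u0 x" if "x \<noteq> 0" for x
  proof (cases "norm x \<ge> 1")
    case True
    define s where "s = x \<bullet> x"
    have s: "1 \<le> s" using True by (simp add: s_def power2_norm_eq_inner [symmetric])
    have "norm x powr (- l) = s powr (- l / 2)" unfolding s_def by (simp only: powr_inner_self)
    also have "\<dots> = s powr (- \<sigma> / 2) * s powr (- a)"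
      by (simp add: a_def field_simps flip: powr_add)
    finally have l: "norm x powr (- l) = s powr (- \<sigma> / 2) * s powr (- a)" .
    have "(2 * s) powr (- a) \<le> (1 + s) powr (- a)" using s a by (intro powr_mono2') auto
    then have "2 powr a * (2 * s) powr (- a) \<le> 2 powr a * (1 + s) powr (- a)"
      by (intro mult_left_mono) auto
    moreover have "2 powr a * (2 * s) powr (- a) = s powr (- a)"
      using s by (simp add: powr_mult powr_minus)
    ultimately have "b * (s powr (- \<sigma> / 2) * s powr (- a))
        \<le> (b + L) * (s powr (- \<sigma> / 2) * (2 powr a * (1 + s) powr (- a)))"
      using assms(6) L by (intro mult_mono) auto
    then have "V s - C1 * s powr (- \<sigma> / 2) * (1 + s) powr (- a) \<le> v_infty p x - b * norm x powr (- l)"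
      unfolding l v by (simp add: s_def C1_def mult_ac)
    also have "\<dots> \<le> u0 x" by (rule assms(8)[OF True])
    finally show ?thesis using s assms(4)[OF that]
      by (simp add: g_def G_def V_def max_absorb1 flip: s_def)
  next
    case False
    then have "x \<bullet> x \<le> 1" by (simp add: power2_norm_eq_inner [symmetric] power_le_one)
    then have "g x = max 0 (L - C1 * 2 powr (- a))" by (simp add: g_def G_def max_absorb2)
    also have "L - C1 * 2 powr (- a) = - b" by (simp add: C1_def powr_minus field_simps)
    finally show ?thesis using assms(4)[OF that] assms(6) by simp
  qed
  obtain F F1 F2 M where F:
    "\<And>y. y > 0 \<Longrightarrow> (F has_real_derivative F1 y) (at y)"
    "\<And>y. y > 0 \<Longrightarrow> (F1 has_real_derivative F2 y) (at y)"
    "\<And>y. y > 0 \<Longrightarrow> 4 * y * F2 y + (2 * d + y) * F1 y + a * F y \<le> 0"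
    "\<And>y. y > 0 \<Longrightarrow> (1 + y) powr (- a) \<le> F y"
    and M: "\<And>y. y > 0 \<Longrightarrow> F y \<le> M"
    using selfsimilar_supersolution_profile[OF a d(1)] by metis
  have "0 < (1 + 1) powr (- a)" by simp
  also have "\<dots> \<le> M" using F(4)[of 1] M[of 1] by simp
  finally have M0: "M > 0" .
  obtain uN where uN: "\<And>N. N > 0 \<Longrightarrow> global_solution p (\<lambda>x. min (u0 x) N) (uN N)"
    and lim: "\<And>x t. x \<noteq> 0 \<Longrightarrow> t > 0 \<Longrightarrow> ((\<lambda>N. uN N x t) \<longlongrightarrow> u x t) at_top"
    using assms(5) unfolding limit_solution_def by blast
  \<comment> \<open>Since \<open>g \<le> L\<close>, the restriction \<open>N \<ge> L\<close> makes
    \<open>g\<close> a minorant of the truncated datum as well. The bound itself does not depend on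
    \<open>N\<close>.\<close>
  have uN_ge: "V (x \<bullet> x) - 2 powr a * C1 * (x \<bullet> x) powr (- \<sigma> / 2) * (1 + t) powr (- a) * F (x \<bullet> x / (1 + t))
     \<le> uN N x t" if x: "x \<noteq> 0" and t: "t > 0" and N: "N \<ge> L" for x t N
  proof -
    have N0: "N > 0" using N L by simp
    note gs = uN[OF N0]
    show ?thesis unfolding V_def
    proof (rule singular_solution_minus_solution_upper_bound)
      show "classical_heat_power p (uN N)" "\<And>x t. t > 0 \<Longrightarrow> 0 \<le> uN N x t"
        using gs by (auto simp: global_solution_def)
      fix e R :: real
      assume "e > 0"
      obtain \<tau> where \<tau>: "\<tau> > 0" "\<And>x t. norm x \<le> R \<Longrightarrow> 0 < t \<Longrightarrow> t < \<tau> \<Longrightarrow>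
          g x - e \<le> (LINT y|lebesgue. heat_kernel t (x - y) * g y)"
        using heat_semigroup_lower_bound_small_time[OF g_cont g_nonneg g_le \<open>e > 0\<close>] by metis
      have sg: "(LINT y|lebesgue. heat_kernel t (x - y) * g y) \<le> uN N x t" if "t > 0" for x t
      proof (rule global_solution_ge_heat_semigroup[OF gs _ _ _ _ that])
        show "(\<lambda>x. min (u0 x) N) \<in> borel_measurable lebesgue" using assms(3) by measurable
        show "\<bar>min (u0 y) N\<bar> \<le> N" if "y \<noteq> 0" for y using assms(4)[OF that] N0 by auto
        show "g \<in> borel_measurable lebesgue"
          using borel_measurable_continuous_onI[OF g_cont] by (simp add: measurable_completion)
        show "0 \<le> g y \<and> g y \<le> min (u0 y) N" if "y \<noteq> 0" for y
          using g_nonneg[of y] g_le[of y] g_le_u0[OF that] N by auto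
      qed
      show "\<exists>\<tau>>0. \<forall>x t. x \<noteq> 0 \<longrightarrow> norm x \<le> R \<longrightarrow> 0 < t \<longrightarrow> t < \<tau> \<longrightarrow>
          L * (x \<bullet> x) powr (- m / 2) - C1 * (x \<bullet> x) powr (- \<sigma> / 2) * (1 + x \<bullet> x) powr (- a) - e \<le> uN N x t"
      proof (intro exI conjI allI impI)
        fix x :: "real ^ 'n" and t :: real
        assume "x \<noteq> 0" "norm x \<le> R" "0 < t" "t < \<tau>"
        then show "L * (x \<bullet> x) powr (- m / 2)
            - C1 * (x \<bullet> x) powr (- \<sigma> / 2) * (1 + x \<bullet> x) powr (- a) - e \<le> uN N x t"
          using g_ge[of x] \<tau>(2)[of x t] sg[of t x] unfolding V_def by linarith
      qed (rule \<tau>(1))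
    qed (use F p1 props pm a C1 L d x t in \<open>auto simp: d_def\<close>)
  qed
  define C where "C = 2 powr a * C1 * M"
  have C: "C > 0" using C1 M0 by (simp add: C_def)
  \<comment> \<open>The bound passes to the limit in \<open>N\<close>; then \<open>F \<le> M\<close>
    and \<open>(1 + t) powr (- a) \<le> t powr (- a)\<close> simplify it. Both claims are read off
    from here.\<close>
  have main: "v_infty p x - u x t \<le> C * norm x powr (- \<sigma>) * t powr (- a)"
    if x: "x \<noteq> 0" and t: "t > 0" for x t
  proof -
    define s where "s = x \<bullet> x"
    have s: "s > 0" using x by (simp add: s_def)
    have "V s - 2 powr a * C1 * s powr (- \<sigma> / 2) * (1 + t) powr (- a) * F (s / (1 + t)) \<le> u x t"
      unfolding s_def
      by (rule tendsto_lowerbound[OF lim[OF x t] eventually_mono[OF eventually_ge_at_top[of L] uN_ge[OF x t]]])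
        simp_all
    moreover have "2 powr a * C1 * s powr (- \<sigma> / 2) * (1 + t) powr (- a) * F (s / (1 + t))
        \<le> 2 powr a * C1 * s powr (- \<sigma> / 2) * t powr (- a) * M"
      using s t a C1 M[of "s / (1 + t)"] F(4)[of "s / (1 + t)"]
      by (intro mult_mono mult_left_mono powr_mono2') (auto intro: order_trans[OF powr_ge_zero])
    moreover have "s powr (- \<sigma> / 2) = norm x powr (- \<sigma>)" unfolding s_def by (simp only: powr_inner_self)
    ultimately show ?thesis by (simp add: v C_def s_def [symmetric] mult_ac)
  qed
  show ?thesis unfolding \<sigma>_def [symmetric]
  proof (intro exI[of _ C] conjI allI impI)
    show "C > 0" by (rule C)
    fix t :: real assume t: "t \<ge> 1"
    show "(SUP x\<in>{x. x \<noteq> 0 \<and> norm x \<le> sqrt t}. ereal (norm x powr \<sigma> * (v_infty p x - u x t)))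
       \<le> ereal (C * t powr (- ((l - \<sigma>) / 2)))"
    proof (rule SUP_least)
      fix x :: "real ^ 'n" assume "x \<in> {x. x \<noteq> 0 \<and> norm x \<le> sqrt t}"
      then have x: "x \<noteq> 0" by simp
      have "norm x powr \<sigma> * (v_infty p x - u x t) \<le> norm x powr \<sigma> * (C * norm x powr (- \<sigma>) * t powr (- a))"
        using t by (intro mult_left_mono main x) auto
      also have "\<dots> = C * t powr (- a)" using x by (simp add: powr_minus)
      finally show "ereal (norm x powr \<sigma> * (v_infty p x - u x t)) \<le> ereal (C * t powr (- ((l - \<sigma>) / 2)))"
        by (simp add: a_def)
    qed
    show "(SUP x\<in>{x. x \<noteq> 0 \<and> norm x \<ge> sqrt t}. ereal (v_infty p x - u x t)) \<le> ereal (C * t powr (- (l / 2)))"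
    proof (rule SUP_least)
      fix x :: "real ^ 'n" assume "x \<in> {x. x \<noteq> 0 \<and> norm x \<ge> sqrt t}"
      then have x: "x \<noteq> 0" "sqrt t \<le> norm x" by auto
      \<comment> \<open>Outside the parabola the weight supplies the missing factor
        \<open>t powr (- \<sigma> / 2)\<close>, and \<open>\<sigma> / 2 + a = l / 2\<close>.\<close>
      have "norm x powr (- \<sigma>) \<le> sqrt t powr (- \<sigma>)"
        using x t props by (intro powr_mono2') auto
      also have "\<dots> = t powr (- \<sigma> / 2)" using t by (simp add: powr_powr flip: powr_half_sqrt)
      finally have "C * norm x powr (- \<sigma>) * t powr (- a) \<le> C * t powr (- \<sigma> / 2) * t powr (- a)"
        using C by (intro mult_right_mono mult_left_mono) auto
      also have "\<dots> = C * t powr (- (l / 2))"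
        by (simp add: a_def mult.assoc field_simps flip: powr_add)
      finally show "ereal (v_infty p x - u x t) \<le> ereal (C * t powr (- (l / 2)))"
        using main[OF x(1), of t] t by simp
    qed
  qed
qed

end
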